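(* There exists an infinite sequence $(\Gamma_n)_{n=1}^\infty$ of CNF formulas such that $\Gamma_n$ admits $\mathsf{SBC}^-$ proofs of size $n^{O(1)}$ but requires $\mathsf{RAT}^-$ proofs of size $2^{\Omega(n)}$.
   Context: A literal is a propositional variable or its negation; $\overline{p}$ is the complement of $p$, and $\overline{L}=\{\overline{p} : p\in L\}$ for a set $L$ of literals. A set of literals is tautological if it contains some $x$ and $\overline{x}$. A clause is a finite nontautological set of literals (read as a disjunction); $\bot$ is the empty clause. A CNF is a finite set of clauses; $\mathrm{var}(\Gamma)$ is the set of variables occurring in $\Gamma$. "Proof" of $\Gamma$ means refutation. Resolution. If $A\cup\{x\}$ and $B\cup\{\overline{x}\}$ are clauses with $x$ a variable not occurring in $A$ or $B$, and $A\cup B$ is a clause, then $A\cup B$ is their resolvent on $x$. A weakening of a clause $A$ is any clause $A\cup B$. A resolution proof of $\Gamma$ is a sequence $(\Gamma_1,\dots,\Gamma_N)$ of CNFs with $\Gamma_1=\Gamma$, $\bot\in\Gamma_N$, and each $\Gamma_{i+1}=\Gamma_i\cup\{C\}$, where $C$ is a resolvent of two clauses of $\Gamma_i$ or a weakening of a clause of $\Gamma_i$. Its size is $N$. Unit propagation. A unit propagation proof is a resolution proof in which, in each use of the resolution rule, one of the two premises is a clause with a single literal. For a set $L$ of literals, $\Gamma\vdash_1 L$ means that $\Gamma\cup\{\{\overline{p}\} : p\in L\}$ has a unit propagation proof. RAT. A clause $C=\{p\}\cup C'$ (with the variable of $p$ not in $C'$) is a RAT for $p$ with respect to $\Gamma$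 if for every clause $D\in\Gamma$ of the form $\{\overline{p}\}\cup D'$ (with the variable of $p$ not in $D'$) we have $\Gamma\vdash_1 C'\cup D'$. $C$ is a RAT with respect to $\Gamma$ if it is one for some $p\in C$. SBC. A clause $C$ is a set-blocked clause (SBC) for a nonempty $L\subseteq C$ with respect to $\Gamma$ if for every $D\in\Gamma$ with $D\cap\overline{L}\neq\varnothing$ and $D\cap L=\varnothing$ the set $(C\setminus L)\cup(D\setminus\overline{L})$ is tautological. $C$ is an SBC with respect to $\Gamma$ if it is one for some nonempty $L\subseteq C$. A $\mathsf{RAT}$ (respectively $\mathsf{SBC}$) proof of $\Gamma$ is defined like a resolution proof, except that each added clause $C$ may also be any RAT (respectively SBC) with respect to the current CNF $\Gamma_i$; its size is $N$. The superscript "$-$" means that only variables of $\mathrm{var}(\Gamma)$ may occur in the proof. *)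

theory Defs
  imports Complex_Main
begin

datatype 'v literal = Pos (lvar: 'v) | Neg (lvar: 'v)

fun compl :: "'v literal \<Rightarrow> 'v literal" where
  "compl (Pos x) = Neg x"
| "compl (Neg x) = Pos x"

text \<open>Clauses and CNFs are represented by raw sets; finiteness and nontautologicality are
  imposed by the predicates \<open>is_clause\<close> and \<open>is_cnf\<close>.\<close>

type_synonym 'v clause = "'v literal set"
type_synonym 'v cnf = "'v clause set"

definition tautological :: "'v literal set \<Rightarrow> bool" where
  "tautological S \<longleftrightarrow> (\<exists>x. Pos x \<in> S \<and> Neg x \<in> S)"

definition is_clause :: "'v clause \<Rightarrow> bool" where
  "is_clause C \<longleftrightarrow> finite C \<and> \<not> tautological C"

definition is_cnf :: "'v cnf \<Rightarrow> bool" where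
  "is_cnf \<Gamma> \<longleftrightarrow> finite \<Gamma> \<and> (\<forall>C\<in>\<Gamma>. is_clause C)"

definition cnf_vars :: "'v cnf \<Rightarrow> 'v set" where
  "cnf_vars \<Gamma> = (\<Union>C\<in>\<Gamma>. lvar ` C)"

definition resolvent :: "'v clause \<Rightarrow> 'v clause \<Rightarrow> 'v clause \<Rightarrow> bool" where
  "resolvent P Q C \<longleftrightarrow> (\<exists>x A B. P = A \<union> {Pos x} \<and> Q = B \<union> {Neg x} \<and>
     x \<notin> lvar ` A \<and> x \<notin> lvar ` B \<and> C = A \<union> B \<and>
     is_clause P \<and> is_clause Q \<and> is_clause C)"

definition weakening :: "'v clause \<Rightarrow> 'v clause \<Rightarrow> bool" where
  "weakening A C \<longleftrightarrow> is_clause C \<and> (\<exists>B. C = A \<union> B)"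

definition resolution_rule :: "'v cnf \<Rightarrow> 'v clause \<Rightarrow> bool" where
  "resolution_rule \<Gamma> C \<longleftrightarrow>
     (\<exists>P\<in>\<Gamma>. \<exists>Q\<in>\<Gamma>. resolvent P Q C) \<or> (\<exists>A\<in>\<Gamma>. weakening A C)"

definition unit_rule :: "'v cnf \<Rightarrow> 'v clause \<Rightarrow> bool" where
  "unit_rule \<Gamma> C \<longleftrightarrow>
     (\<exists>P\<in>\<Gamma>. \<exists>Q\<in>\<Gamma>. resolvent P Q C \<and> (is_singleton P \<or> is_singleton Q)) \<or>
     (\<exists>A\<in>\<Gamma>. weakening A C)"

text \<open>\<open>is_proof R \<Gamma> \<Delta>s\<close>: the list \<open>\<Delta>s\<close> of CNFs is a refutation of \<open>\<Gamma>\<close> in which a clause \<open>C\<close>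
  may be added to the current CNF \<open>\<Delta>\<close> whenever \<open>R \<Delta> C\<close> holds. The size of the proof is
  \<open>length \<Delta>s\<close>.\<close>

definition is_proof :: "('v cnf \<Rightarrow> 'v clause \<Rightarrow> bool) \<Rightarrow> 'v cnf \<Rightarrow> 'v cnf list \<Rightarrow> bool" where
  "is_proof R \<Gamma> \<Delta>s \<longleftrightarrow>
     \<Delta>s \<noteq> [] \<and> (\<forall>\<Delta>\<in>set \<Delta>s. is_cnf \<Delta>) \<and> hd \<Delta>s = \<Gamma> \<and> {} \<in> last \<Delta>s \<and>
     (\<forall>i. Suc i < length \<Delta>s \<longrightarrow> (\<exists>C. R (\<Delta>s ! i) C \<and> \<Delta>s ! Suc i = \<Delta>s ! i \<union> {C}))"

definition unit_implies :: "'v cnf \<Rightarrow> 'v literal set \<Rightarrow> bool"  (infix "\<turnstile>\<^sub>1" 50) where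
  "\<Gamma> \<turnstile>\<^sub>1 L \<longleftrightarrow> (\<exists>\<Delta>s. is_proof unit_rule (\<Gamma> \<union> {{compl p} | p. p \<in> L}) \<Delta>s)"

definition rat_for :: "'v literal \<Rightarrow> 'v cnf \<Rightarrow> 'v clause \<Rightarrow> bool" where
  "rat_for p \<Gamma> C \<longleftrightarrow> is_clause C \<and>
     (\<exists>C'. C = {p} \<union> C' \<and> lvar p \<notin> lvar ` C' \<and>
        (\<forall>D\<in>\<Gamma>. \<forall>D'. D = {compl p} \<union> D' \<and> lvar p \<notin> lvar ` D' \<longrightarrow> \<Gamma> \<turnstile>\<^sub>1 C' \<union> D'))"

definition rat :: "'v cnf \<Rightarrow> 'v clause \<Rightarrow> bool" where
  "rat \<Gamma> C \<longleftrightarrow> (\<exists>p\<in>C. rat_for p \<Gamma> C)"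

definition sbc_for :: "'v literal set \<Rightarrow> 'v cnf \<Rightarrow> 'v clause \<Rightarrow> bool" where
  "sbc_for L \<Gamma> C \<longleftrightarrow> is_clause C \<and> L \<noteq> {} \<and> L \<subseteq> C \<and>
     (\<forall>D\<in>\<Gamma>. D \<inter> compl ` L \<noteq> {} \<and> D \<inter> L = {} \<longrightarrow>
        tautological ((C - L) \<union> (D - compl ` L)))"

definition sbc :: "'v cnf \<Rightarrow> 'v clause \<Rightarrow> bool" where
  "sbc \<Gamma> C \<longleftrightarrow> (\<exists>L. sbc_for L \<Gamma> C)"

definition rat_proof :: "'v cnf \<Rightarrow> 'v cnf list \<Rightarrow> bool" where
  "rat_proof = is_proof (\<lambda>\<Delta> C. resolution_rule \<Delta> C \<or> rat \<Delta> C)"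

definition sbc_proof :: "'v cnf \<Rightarrow> 'v cnf list \<Rightarrow> bool" where
  "sbc_proof = is_proof (\<lambda>\<Delta> C. resolution_rule \<Delta> C \<or> sbc \<Delta> C)"

definition no_new_vars :: "'v cnf \<Rightarrow> 'v cnf list \<Rightarrow> bool" where
  "no_new_vars \<Gamma> \<Delta>s \<longleftrightarrow> (\<forall>\<Delta>\<in>set \<Delta>s. cnf_vars \<Delta> \<subseteq> cnf_vars \<Gamma>)"

definition rat_minus_proof :: "'v cnf \<Rightarrow> 'v cnf list \<Rightarrow> bool" where
  "rat_minus_proof \<Gamma> \<Delta>s \<longleftrightarrow> rat_proof \<Gamma> \<Delta>s \<and> no_new_vars \<Gamma> \<Delta>s"

definition sbc_minus_proof :: "'v cnf \<Rightarrow> 'v cnf list \<Rightarrow> bool" where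
  "sbc_minus_proof \<Gamma> \<Delta>s \<longleftrightarrow> sbc_proof \<Gamma> \<Delta>s \<and> no_new_vars \<Gamma> \<Delta>s"

end

theory Submission
  imports Defs "HOL-Library.Nat_Bijection" "HOL-Real_Asymp.Real_Asymp"
begin

text \<open>The formulas are pigeonhole principles in which each variable \<open>x\<close> has a twin \<open>x'\<close> forced to
  be equal to it. A RAT for \<open>p\<close> is checked in particular against the clause \<open>{\<not>p, p'}\<close>, which
  makes the RAT a consequence of the current clauses by unit propagation. So RAT proofs without new
  variables are no stronger than resolution, and the method of Beame and Pitassi gives an
  exponential lower bound. Set-blocked clauses, on the other hand, can flip \<open>x\<close> and \<open>x'\<close> together.
  They can express that exchanging the contents of two holes is harmless, which allows one to
  assume for \<open>h = n - 1, \<dots>, 0\<close> that pigeon \<open>h + 1\<close> sits in hole \<open>h\<close> unless hole \<open>h\<close> contains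
  none of the pigeons \<open>0, \<dots>, h\<close>; this removes one pigeon and one hole at a time.\<close>

section \<open>Literals and assignments\<close>

text \<open>Cook's reduction of the pigeonhole principle from \<open>h + 1\<close> holes to
  \<open>h\<close> normally introduces new variables for the rerouted pigeons. Excluding one of two
  interchangeable hole contents by a set-blocked clause has the same effect in the original
  variables. Blockedness can be lost when clauses are added, so all swap clauses come first and only
  resolution follows. For the lower bound the syntax is discarded. What is counted is a set
  \<open>T\<close> of clauses derived by sound two-premise inferences over assignments that respect
  twins; a RAT costs at most \<open>card V + 2\<close> of them, a polynomial loss that is harmless
  against \<open>(36 / 35) ^ (n div 2)\<close>. The critical assignments of the pigeonhole principle
  survive the doubling, as they simply give both copies the same value.\<close>

fun holds :: "('v \<Rightarrow> bool) \<Rightarrow> 'v literal \<Rightarrow> bool" where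
  "holds \<alpha> (Pos x) = \<alpha> x"
| "holds \<alpha> (Neg x) = (\<not> \<alpha> x)"

definition models :: "('v \<Rightarrow> bool) \<Rightarrow> 'v literal set \<Rightarrow> bool" where
  "models \<alpha> C \<longleftrightarrow> (\<exists>l\<in>C. holds \<alpha> l)"

lemma compl_compl [simp]: "compl (compl l) = l"
  by (cases l) auto

lemma lvar_compl [simp]: "lvar (compl l) = lvar l"
  by (cases l) auto

lemma holds_compl [simp]: "holds \<alpha> (compl l) \<longleftrightarrow> \<not> holds \<alpha> l"
  by (cases l) auto

lemma lvar_eq_iff: "lvar l = lvar k \<longleftrightarrow> k = l \<or> k = compl l"
  by (cases l; cases k) auto

lemma mem_lvar_image: "lvar l \<in> lvar ` A \<longleftrightarrow> l \<in> A \<or> compl l \<in> A"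
  by (force simp: image_iff lvar_eq_iff)

lemma mem_compl_image: "l \<in> compl ` A \<longleftrightarrow> compl l \<in> A"
  by (force simp: image_iff)

lemma tautological_iff: "tautological S \<longleftrightarrow> (\<exists>l. l \<in> S \<and> compl l \<in> S)"
  unfolding tautological_def
proof
  show "\<exists>x. Pos x \<in> S \<and> Neg x \<in> S" if "\<exists>l. l \<in> S \<and> compl l \<in> S"
  proof -
    from that obtain l where "l \<in> S" "compl l \<in> S" by blast
    then show ?thesis by (cases l) auto
  qed
qed (metis compl.simps(1))

lemma models_mono: "models \<alpha> C \<Longrightarrow> C \<subseteq> D \<Longrightarrow> models \<alpha> D"
  by (auto simp: models_def)

lemma is_clause_subset: "is_clause C \<Longrightarrow> D \<subseteq> C \<Longrightarrow> is_clause D"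
  by (auto simp: is_clause_def tautological_def intro: finite_subset)

lemma lvar_image_finite: "finite X \<Longrightarrow> lvar ` A \<subseteq> X \<Longrightarrow> finite A \<and> card A \<le> 2 * card X"
proof -
  assume X: "finite X" and A: "lvar ` A \<subseteq> X"
  have "l \<in> Pos ` X \<union> Neg ` X" if "l \<in> A" for l
    using A that by (cases l) auto
  then have sub: "A \<subseteq> Pos ` X \<union> Neg ` X" by blast
  have "card (Pos ` X \<union> Neg ` X) \<le> card X + card X"
    by (meson X card_Un_le card_image_le add_mono order_trans)
  then show ?thesis
    using sub X card_mono[OF _ sub] finite_subset[OF sub] by auto
qed

section \<open>Unit propagation\<close>

text \<open>If the partial assignment falsifying \<open>M\<close> met neither a conflict clause nor
  a clause with exactly one unassigned and no true literal, an invariant would separate all clauses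
  of a unit refutation from the empty clause. So propagation can always go on for one more
  round.\<close>

lemma unit_implies_progress:
  assumes "\<Gamma> \<turnstile>\<^sub>1 L" "L \<subseteq> M" "\<not> tautological M"
  obtains D where "D \<in> \<Gamma>" "D \<subseteq> M"
  | D l where "D \<in> \<Gamma>" "l \<in> D" "D \<subseteq> insert l M" "l \<notin> M" "compl l \<notin> M"
proof (rule ccontr)
  assume "\<not> thesis"
  then have no_conflict: "\<And>D. D \<in> \<Gamma> \<Longrightarrow> \<not> D \<subseteq> M"
    and no_unit: "\<And>D l. D \<in> \<Gamma> \<Longrightarrow> l \<in> D \<Longrightarrow> D \<subseteq> insert l M \<Longrightarrow> l \<notin> M \<Longrightarrow> compl l \<in> M"
    using that by blast+
  \<comment> \<open>A clause is watched by the partial assignment falsifying \<open>M\<close> if it is satisfied by it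
    or has two unassigned literals; unit resolution preserves this.\<close>
  define inv where "inv F \<longleftrightarrow> (\<exists>l\<in>F. compl l \<in> M) \<or> (\<exists>l\<in>F. \<exists>k\<in>F. l \<noteq> k \<and> l \<notin> M \<and> k \<notin> M)" for F
  obtain \<Delta>s where \<Delta>s: "is_proof unit_rule (\<Gamma> \<union> {{compl p} | p. p \<in> L}) \<Delta>s"
    using assms(1) unfolding unit_implies_def by blast
  have base: "inv D" if D: "D \<in> \<Gamma>" for D
  proof (rule ccontr)
    assume "\<not> inv D"
    then have no_true: "\<And>l. l \<in> D \<Longrightarrow> compl l \<notin> M"
      and one: "\<And>l k. l \<in> D \<Longrightarrow> k \<in> D \<Longrightarrow> l \<notin> M \<Longrightarrow> k \<notin> M \<Longrightarrow> l = k"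
      unfolding inv_def by blast+
    obtain l where l: "l \<in> D" "l \<notin> M" using no_conflict[OF D] by blast
    then have "D \<subseteq> insert l M" using one by blast
    then show False using no_unit[OF D] l no_true by blast
  qed
  have init: "inv F" if "F \<in> \<Gamma> \<union> {{compl p} | p. p \<in> L}" for F
    using that
  proof
    assume "F \<in> {{compl p} | p. p \<in> L}"
    then show ?thesis using assms(2) by (auto simp: inv_def)
  qed (rule base)
  \<comment> \<open>A unit clause with the invariant must be satisfied, so \<open>compl p\<close> is
    false and witnesses nothing in the other premise; the witnesses lie in \<open>B\<close>.\<close>
  have unit_res: "inv B" if "inv {p}" "inv (insert (compl p) B)" "lvar p \<notin> lvar ` B" for p B
  proof -
    have p: "compl p \<in> M" using that(1) by (auto simp: inv_def)
    then have "p \<notin> M" using assms(3) by (auto simp: tautological_iff)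
    then show ?thesis using that(2) p unfolding inv_def by auto
  qed
  have singleton_empty: "A = {}" if "is_singleton (A \<union> {l})" "lvar l \<notin> lvar ` A" for A and l :: "'a literal"
  proof -
    have "A \<subseteq> {l}" using that(1) by (auto simp: is_singleton_def)
    then show ?thesis using that(2) by blast
  qed
  have rule: "inv C" if "unit_rule \<Delta> C" "\<forall>F\<in>\<Delta>. inv F" for \<Delta> C
    using that(1) unfolding unit_rule_def
  proof
    assume "\<exists>P\<in>\<Delta>. \<exists>Q\<in>\<Delta>. resolvent P Q C \<and> (is_singleton P \<or> is_singleton Q)"
    then obtain P Q where PQ: "P \<in> \<Delta>" "Q \<in> \<Delta>" "resolvent P Q C"
      and sing: "is_singleton P \<or> is_singleton Q" by blast
    obtain x A B where x: "P = A \<union> {Pos x}" "Q = B \<union> {Neg x}" "x \<notin> lvar ` A" "x \<notin> lvar ` B"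
      "C = A \<union> B"
      using PQ(3) unfolding resolvent_def by blast
    from sing show "inv C"
    proof
      assume "is_singleton P"
      then have "A = {}" using x(1,3) by (intro singleton_empty[of A "Pos x"]) simp_all
      then show ?thesis using unit_res[of "Pos x" B] that(2) PQ x by auto
    next
      assume "is_singleton Q"
      then have "B = {}" using x(2,4) by (intro singleton_empty[of B "Neg x"]) simp_all
      then show ?thesis using unit_res[of "Neg x" A] that(2) PQ x by auto
    qed
  next
    assume "\<exists>A\<in>\<Delta>. weakening A C"
    then show "inv C" using that(2) by (fastforce simp: weakening_def inv_def)
  qed
  have "\<forall>F\<in>\<Delta>s ! i. inv F" if "i < length \<Delta>s" for i
    using that
  proof (induction i)
    case 0
    then show ?case using \<Delta>s init by (auto simp: is_proof_def hd_conv_nth)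
  next
    case (Suc i)
    then obtain C where "unit_rule (\<Delta>s ! i) C" "\<Delta>s ! Suc i = \<Delta>s ! i \<union> {C}"
      using \<Delta>s by (auto simp: is_proof_def)
    then show ?case using Suc rule by auto
  qed
  moreover have "{} \<in> \<Delta>s ! (length \<Delta>s - 1)" "length \<Delta>s - 1 < length \<Delta>s"
    using \<Delta>s by (auto simp: is_proof_def last_conv_nth)
  ultimately have "inv {}" by blast
  then show False by (simp add: inv_def)
qed

section \<open>RAT proofs in the presence of twin variables\<close>

text \<open>One semantic rule covers resolution, weakening (with \<open>E = F\<close>), a
  propagation round and the replacement of a literal by its twin.\<close>

definition twin_entails :: "('v \<Rightarrow> 'v) \<Rightarrow> 'v literal set \<Rightarrow> 'v literal set \<Rightarrow> 'v literal set \<Rightarrow> bool" where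
  "twin_entails t E F G \<longleftrightarrow>
     (\<forall>\<alpha>. (\<forall>x. \<alpha> (t x) = \<alpha> x) \<longrightarrow> models \<alpha> E \<longrightarrow> models \<alpha> F \<longrightarrow> models \<alpha> G)"

text \<open>Conclusions are confined to an explicit set \<open>T\<close>, so that
  \<open>card T\<close> measures a derivation without any bookkeeping of the order and reuse of
  lines. Axioms are not charged.\<close>

inductive_set derivable :: "('v \<Rightarrow> 'v) \<Rightarrow> 'v literal set set \<Rightarrow> 'v cnf \<Rightarrow> 'v literal set set"
  for t T \<Gamma> where
  axiom: "D \<in> \<Gamma> \<Longrightarrow> D \<in> derivable t T \<Gamma>"
| step: "E \<in> derivable t T \<Gamma> \<Longrightarrow> F \<in> derivable t T \<Gamma> \<Longrightarrow> G \<in> T \<Longrightarrow> twin_entails t E F G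
    \<Longrightarrow> G \<in> derivable t T \<Gamma>"

lemma derivable_trans:
  assumes "C \<in> derivable t T' \<Delta>" "\<Delta> \<subseteq> derivable t T \<Gamma>" "T \<subseteq> T''" "T' \<subseteq> T''"
  shows "C \<in> derivable t T'' \<Gamma>"
  using assms(1)
proof induction
  case (axiom D)
  then have "D \<in> derivable t T \<Gamma>" using assms(2) by blast
  then show ?case
    by induction (use assms(3) in \<open>auto intro: derivable.intros\<close>)
next
  case (step E F G)
  then show ?case using assms(4) by (auto intro: derivable.step)
qed

lemma derivable_mono: "T \<subseteq> T' \<Longrightarrow> derivable t T \<Gamma> \<subseteq> derivable t T' \<Gamma>"
  using derivable_trans[of _ t T \<Gamma> "{}" \<Gamma> T'] by (auto intro: derivable.axiom)

text \<open>Propagation is read backwards. It enlarges \<open>M\<close>, starting from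
  \<open>L\<close>, until a conflict clause gives \<open>M\<close> by weakening; on the way back,
  each \<open>M\<close> follows from the unit clause \<open>D\<close> and
  \<open>insert (compl l) M\<close>. Every round assigns a new variable of \<open>V\<close>, which
  bounds the number of clauses.\<close>

lemma unit_implies_derivable:
  assumes "\<Gamma> \<turnstile>\<^sub>1 L" "finite V" "cnf_vars \<Gamma> \<subseteq> V" "\<Gamma> \<noteq> {}"
  shows "\<exists>T. finite T \<and> card T \<le> Suc (card V) \<and> L \<in> derivable t T \<Gamma>"
proof -
  have "\<exists>T. finite T \<and> card T \<le> Suc (card (V - lvar ` M)) \<and> M \<in> derivable t T \<Gamma>"
    if "L \<subseteq> M" for M
    using that
  proof (induction "card (V - lvar ` M)" arbitrary: M rule: less_induct)
    case less
    have one: ?case if "D \<in> \<Gamma>" "twin_entails t D D M" for D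
      by (rule exI[of _ "{M}"]) (use that in \<open>auto intro: derivable.intros\<close>)
    show ?case
    proof (cases "tautological M")
      case True
      obtain D where "D \<in> \<Gamma>" using assms(4) by blast
      moreover have "models \<alpha> M" for \<alpha>
        using True unfolding tautological_iff models_def by (metis holds_compl)
      ultimately show ?thesis by (intro one[of D]) (simp_all add: twin_entails_def)
    next
      case False
      from assms(1) less(2) False show ?thesis
      proof (cases rule: unit_implies_progress)
        case (1 D)
        then show ?thesis by (intro one[of D]) (auto simp: twin_entails_def intro: models_mono)
      next
        case (2 D l)
        let ?M = "insert (compl l) M"
        have l: "lvar l \<in> V - lvar ` M"
          using 2 assms(3) by (auto simp: mem_lvar_image cnf_vars_def)
        have eq: "V - lvar ` ?M = (V - lvar ` M) - {lvar l}" by auto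
        have card: "card (V - lvar ` M) = Suc (card (V - lvar ` ?M))"
          unfolding eq using l assms(2) by (intro card.remove) auto
        then obtain T where T: "finite T" "card T \<le> Suc (card (V - lvar ` ?M))"
          "?M \<in> derivable t T \<Gamma>"
          using less(1)[of ?M] less(2) by auto
        have "?M \<in> derivable t (insert M T) \<Gamma>"
          using T(3) derivable_mono[of T "insert M T"] by blast
        moreover have "twin_entails t D ?M M"
          unfolding twin_entails_def models_def
        proof (intro allI impI)
          fix \<alpha> assume "\<exists>l\<in>D. holds \<alpha> l" "\<exists>l\<in>?M. holds \<alpha> l"
          then show "\<exists>l\<in>M. holds \<alpha> l" using 2 by (cases "holds \<alpha> l") auto
        qed
        ultimately have "M \<in> derivable t (insert M T) \<Gamma>"
          using derivable.step[OF derivable.axiom[OF 2(1)], of ?M t "insert M T" M] by blast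
        then show ?thesis
          using T card by (intro exI[of _ "insert M T"]) (auto simp: card_insert_if)
      qed
    qed
  qed
  from this[of L] show ?thesis
    using card_mono[of V "V - lvar ` L"] assms(2) by fastforce
qed

text \<open>\<open>t_neq\<close> gives \<open>{compl p, q}\<close>, for the twin \<open>q\<close> of
  \<open>p\<close>, the shape required by the RAT condition: the rest \<open>{q}\<close> avoids the
  variable of \<open>p\<close>.\<close>

locale twins =
  fixes t :: "'v \<Rightarrow> 'v" and \<Gamma> :: "'v cnf"
  assumes cnf: "is_cnf \<Gamma>"
    and t_neq: "t x \<noteq> x"
    and t_imp: "x \<in> cnf_vars \<Gamma> \<Longrightarrow> {Neg x, Pos (t x)} \<in> \<Gamma>" "x \<in> cnf_vars \<Gamma> \<Longrightarrow> {Pos x, Neg (t x)} \<in> \<Gamma>"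
begin

text \<open>If \<open>q\<close> is the twin literal of \<open>p\<close>, then the clause \<open>{\<not>p, q}\<close> forces a RAT \<open>{p} \<union> C'\<close> for
  \<open>p\<close> to satisfy \<open>\<Delta> \<turnstile>\<^sub>1 C' \<union> {q}\<close>, so the RAT is already implied.\<close>

lemma rat_derivable:
  assumes "rat \<Delta> C" "\<Gamma> \<subseteq> \<Delta>" "lvar ` C \<subseteq> cnf_vars \<Gamma>" "finite V" "cnf_vars \<Delta> \<subseteq> V"
  shows "\<exists>T. finite T \<and> card T \<le> card V + 2 \<and> C \<in> derivable t T \<Delta>"
proof -
  obtain p C' where p: "p \<in> C" "C = {p} \<union> C'" "lvar p \<notin> lvar ` C'"
    and up: "\<And>D D'. D \<in> \<Delta> \<Longrightarrow> D = {compl p} \<union> D' \<Longrightarrow> lvar p \<notin> lvar ` D' \<Longrightarrow> \<Delta> \<turnstile>\<^sub>1 C' \<union> D'"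
  proof -
    from assms(1) obtain p where p: "p \<in> C" "rat_for p \<Delta> C" unfolding rat_def ..
    then obtain C' where "C = {p} \<union> C'" "lvar p \<notin> lvar ` C'"
      "\<forall>D\<in>\<Delta>. \<forall>D'. D = {compl p} \<union> D' \<and> lvar p \<notin> lvar ` D' \<longrightarrow> \<Delta> \<turnstile>\<^sub>1 C' \<union> D'"
      unfolding rat_for_def by (elim conjE exE)
    then show ?thesis using that[OF p(1), of C'] by simp
  qed
  obtain q where q: "{compl p, q} \<in> \<Delta>" "lvar q = t (lvar p)"
    "\<And>\<alpha>. \<forall>x. \<alpha> (t x) = \<alpha> x \<Longrightarrow> holds \<alpha> q = holds \<alpha> p"
  proof -
    have "lvar p \<in> cnf_vars \<Gamma>" using p(1) assms(3) by auto
    then show ?thesis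
      using t_imp[of "lvar p"] assms(2) that[of "map_literal t p"] by (cases p) auto
  qed
  have "\<Delta> \<turnstile>\<^sub>1 C' \<union> {q}"
  proof (rule up)
    show "{compl p, q} = {compl p} \<union> {q}" by auto
    show "lvar p \<notin> lvar ` {q}" using q(2) t_neq[of "lvar p"] by simp
  qed (rule q(1))
  moreover have "\<Delta> \<noteq> {}" using q(1) by auto
  ultimately have "\<exists>T. finite T \<and> card T \<le> Suc (card V) \<and> C' \<union> {q} \<in> derivable t T \<Delta>"
    using assms(4,5) by (simp add: unit_implies_derivable)
  then obtain T where T: "finite T" "card T \<le> Suc (card V)" "C' \<union> {q} \<in> derivable t T \<Delta>"
    by blast
  have "C' \<union> {q} \<in> derivable t (insert C T) \<Delta>"
    using T(3) derivable_mono[of T "insert C T"] by blast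
  moreover have "twin_entails t (C' \<union> {q}) (C' \<union> {q}) C"
    unfolding twin_entails_def models_def using q(3) p(2) by auto
  ultimately have "C \<in> derivable t (insert C T) \<Delta>"
    using derivable.step[of "C' \<union> {q}" t "insert C T" \<Delta> "C' \<union> {q}" C] by blast
  then show ?thesis
    using T by (intro exI[of _ "insert C T"]) (auto simp: card_insert_if)
qed

lemma resolution_derivable:
  assumes "resolution_rule \<Delta> C"
  shows "C \<in> derivable t {C} \<Delta>"
proof -
  obtain P Q where PQ: "P \<in> \<Delta>" "Q \<in> \<Delta>" "twin_entails t P Q C"
    using assms unfolding resolution_rule_def
  proof
    assume "\<exists>P\<in>\<Delta>. \<exists>Q\<in>\<Delta>. resolvent P Q C"
    moreover have "twin_entails t P Q C" if "resolvent P Q C" for P Q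
      using that unfolding resolvent_def twin_entails_def models_def by fastforce
    ultimately show thesis using that by blast
  next
    assume "\<exists>A\<in>\<Delta>. weakening A C"
    moreover have "twin_entails t A A C" if "weakening A C" for A
      using that unfolding weakening_def twin_entails_def models_def by fastforce
    ultimately show thesis using that by blast
  qed
  then show ?thesis using derivable.step[OF derivable.axiom derivable.axiom, of P \<Delta> Q C "{C}" t] by blast
qed

lemma finite_cnf_vars: "finite (cnf_vars \<Gamma>)"
  using cnf by (auto simp: cnf_vars_def is_cnf_def is_clause_def)

lemma rat_minus_proof_derivable:
  assumes "rat_minus_proof \<Gamma> \<Delta>s"
  shows "\<exists>T. finite T \<and> card T \<le> length \<Delta>s * (card (cnf_vars \<Gamma>) + 2) \<and> {} \<in> derivable t T \<Gamma>"
proof -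
  let ?V = "cnf_vars \<Gamma>"
  have pf: "is_proof (\<lambda>\<Delta> C. resolution_rule \<Delta> C \<or> rat \<Delta> C) \<Gamma> \<Delta>s"
    and vars: "\<And>i. i < length \<Delta>s \<Longrightarrow> cnf_vars (\<Delta>s ! i) \<subseteq> ?V"
    using assms by (simp_all add: rat_minus_proof_def rat_proof_def no_new_vars_def)
  have main: "\<Gamma> \<subseteq> \<Delta>s ! i \<and> (\<exists>T. finite T \<and> card T \<le> i * (card ?V + 2) \<and> \<Delta>s ! i \<subseteq> derivable t T \<Gamma>)"
    if "i < length \<Delta>s" for i
    using that
  proof (induction i)
    case 0
    then have "\<Delta>s ! 0 = \<Gamma>" using pf by (auto simp: is_proof_def hd_conv_nth)
    then show ?case by (auto intro!: exI[of _ "{}"] derivable.axiom)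
  next
    case (Suc i)
    let ?\<Delta> = "\<Delta>s ! i"
    obtain C where C: "resolution_rule ?\<Delta> C \<or> rat ?\<Delta> C" "\<Delta>s ! Suc i = ?\<Delta> \<union> {C}"
      using pf Suc.prems unfolding is_proof_def by blast
    obtain T where T: "\<Gamma> \<subseteq> ?\<Delta>" "finite T" "card T \<le> i * (card ?V + 2)" "?\<Delta> \<subseteq> derivable t T \<Gamma>"
      using Suc by auto
    \<comment> \<open>The ban on new variables enters here: twin axioms exist only for the variables
      of \<open>\<Gamma>\<close>.\<close>
    have "lvar ` C \<subseteq> ?V" using vars[OF Suc.prems] C(2) by (auto simp: cnf_vars_def)
    then have "\<exists>T'. finite T' \<and> card T' \<le> card ?V + 2 \<and> C \<in> derivable t T' ?\<Delta>"
      using C(1)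
    proof (elim disjE)
      show ?thesis if "resolution_rule ?\<Delta> C"
        using resolution_derivable[OF that] by (intro exI[of _ "{C}"]) auto
      show ?thesis if "rat ?\<Delta> C" "lvar ` C \<subseteq> ?V"
        using rat_derivable[OF that(1) T(1) that(2) finite_cnf_vars vars] Suc.prems by auto
    qed
    then obtain T' where T': "finite T'" "card T' \<le> card ?V + 2" "C \<in> derivable t T' ?\<Delta>"
      by blast
    have "C \<in> derivable t (T \<union> T') \<Gamma>"
      using T'(3) T(4) by (rule derivable_trans) auto
    moreover have "?\<Delta> \<subseteq> derivable t (T \<union> T') \<Gamma>"
      using T(4) derivable_mono[of T "T \<union> T'"] by blast
    moreover have "card (T \<union> T') \<le> Suc i * (card ?V + 2)"
      using card_Un_le[of T T'] T T' by simp
    ultimately show ?case using T T' C(2) by (intro conjI exI[of _ "T \<union> T'"]) auto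
  qed
  have len: "length \<Delta>s - 1 < length \<Delta>s" and "{} \<in> \<Delta>s ! (length \<Delta>s - 1)"
    using pf by (auto simp: is_proof_def last_conv_nth)
  with main[OF len] obtain T where "finite T" "card T \<le> (length \<Delta>s - 1) * (card ?V + 2)"
    "{} \<in> derivable t T \<Gamma>"
    by auto
  then show ?thesis
    by (meson diff_le_self mult_le_mono1 order_trans)
qed

end

section \<open>The doubled pigeonhole principle\<close>

text \<open>The variables \<open>2 * prod_encode (i, j)\<close> and \<open>2 * prod_encode (i, j) + 1\<close> are two copies of
  the variable saying that pigeon \<open>i\<close> sits in hole \<open>j\<close>.\<close>

definition row :: "nat \<Rightarrow> nat" where "row x = fst (prod_decode (x div 2))"
definition col :: "nat \<Rightarrow> nat" where "col x = snd (prod_decode (x div 2))"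
definition pvar :: "nat \<Rightarrow> nat \<Rightarrow> nat" where "pvar i j = 2 * prod_encode (i, j)"
definition twin :: "nat \<Rightarrow> nat" where "twin x = (if even x then Suc x else x - 1)"

lemma row_pvar [simp]: "row (pvar i j) = i" and col_pvar [simp]: "col (pvar i j) = j"
  by (simp_all add: row_def col_def pvar_def)

lemma twin_neq: "twin x \<noteq> x"
  by (auto simp: twin_def elim!: oddE)

lemma twin_twin [simp]: "twin (twin x) = x"
  by (auto simp: twin_def elim!: oddE)

lemma twin_div2: "twin x div 2 = x div 2"
  by (auto simp: twin_def elim!: oddE)

lemma row_twin [simp]: "row (twin x) = row x" and col_twin [simp]: "col (twin x) = col x"
  by (simp_all add: row_def col_def twin_div2)

lemma pvar_cases: "x = pvar (row x) (col x) \<or> x = twin (pvar (row x) (col x))"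
  by (cases "even x") (auto simp: row_def col_def pvar_def twin_def elim!: oddE)

definition php_vars :: "nat \<Rightarrow> nat set" where
  "php_vars n = {x. row x \<le> n \<and> col x < n}"

definition pigeon_clause :: "nat \<Rightarrow> nat \<Rightarrow> nat clause" where
  "pigeon_clause n i = {Pos (pvar i j) | j. j < n}"

text \<open>Hole axioms range over all pairs of copies, so that any positive literal of a swap
  clause can be resolved away in one step. Since \<open>twin\<close> is an involution, the last
  family contains both implications between twins.\<close>

definition php :: "nat \<Rightarrow> nat cnf" where
  "php n = pigeon_clause n ` {..n}
     \<union> {{Neg x, Neg y} | x y. x \<in> php_vars n \<and> y \<in> php_vars n \<and> col x = col y \<and> row x \<noteq> row y}
     \<union> {{Pos x, Neg (twin x)} | x. x \<in> php_vars n}"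

lemma php_vars_subset:
  "php_vars n \<subseteq> (\<lambda>(i, j). pvar i j) ` ({..n} \<times> {..<n}) \<union> (\<lambda>(i, j). twin (pvar i j)) ` ({..n} \<times> {..<n})"
proof
  fix x assume "x \<in> php_vars n"
  then have "(row x, col x) \<in> {..n} \<times> {..<n}" by (simp add: php_vars_def)
  then show "x \<in> (\<lambda>(i, j). pvar i j) ` ({..n} \<times> {..<n}) \<union> (\<lambda>(i, j). twin (pvar i j)) ` ({..n} \<times> {..<n})"
    using pvar_cases[of x] by force
qed

lemma finite_php_vars [simp]: "finite (php_vars n)"
  using php_vars_subset by (rule finite_subset) auto

lemma card_php_vars: "card (php_vars n) \<le> 2 * (n * (n + 1))"
proof -
  let ?G = "{..n} \<times> {..<n}"
  have "card (php_vars n) \<le> card ((\<lambda>(i, j). pvar i j) ` ?G) + card ((\<lambda>(i, j). twin (pvar i j)) ` ?G)"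
    by (intro order_trans[OF card_mono[OF _ php_vars_subset] card_Un_le]) auto
  also have "\<dots> \<le> card ?G + card ?G"
    by (intro add_mono card_image_le) auto
  finally show ?thesis by simp
qed

lemma pvar_in_php_vars [simp]: "pvar i j \<in> php_vars n \<longleftrightarrow> i \<le> n \<and> j < n"
  by (simp add: php_vars_def)

lemma twin_in_php_vars [simp]: "twin x \<in> php_vars n \<longleftrightarrow> x \<in> php_vars n"
  by (simp add: php_vars_def)

lemma cnf_vars_php: "cnf_vars (php n) = php_vars n"
proof
  show "cnf_vars (php n) \<subseteq> php_vars n"
    by (auto simp: cnf_vars_def php_def pigeon_clause_def)
  show "php_vars n \<subseteq> cnf_vars (php n)"
  proof
    fix x assume "x \<in> php_vars n"
    then have "{Pos x, Neg (twin x)} \<in> php n" unfolding php_def by blast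
    moreover have "x \<in> lvar ` {Pos x, Neg (twin x)}" by simp
    ultimately show "x \<in> cnf_vars (php n)" unfolding cnf_vars_def by blast
  qed
qed

lemma is_cnf_php: "is_cnf (php n)"
proof -
  have fin: "finite (pigeon_clause n i)" for i
    by (auto simp: pigeon_clause_def)
  have "{{Neg x, Neg y} | x y. x \<in> php_vars n \<and> y \<in> php_vars n \<and> col x = col y \<and> row x \<noteq> row y}
      \<subseteq> (\<lambda>(x, y). {Neg x, Neg y}) ` (php_vars n \<times> php_vars n)"
    by auto
  then have 1: "finite {{Neg x, Neg y} | x y. x \<in> php_vars n \<and> y \<in> php_vars n \<and> col x = col y \<and> row x \<noteq> row y}"
    by (rule finite_subset) auto
  have 2: "finite {{Pos x, Neg (twin x)} | x. x \<in> php_vars n}"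
    by (auto simp: Setcompr_eq_image)
  have "is_clause C" if "C \<in> php n" for C
    using that fin twin_neq twin_neq[symmetric] unfolding php_def
    by (auto simp: is_clause_def tautological_def pigeon_clause_def)
  then show ?thesis using 1 2 by (auto simp: is_cnf_def php_def)
qed

lemma twins_php: "twins twin (php n)"
proof
  have twin_axiom: "{Pos x, Neg (twin x)} \<in> php n" if "x \<in> php_vars n" for x
    using that unfolding php_def by blast
  fix x assume x: "x \<in> cnf_vars (php n)"
  then show "{Pos x, Neg (twin x)} \<in> php n"
    by (simp add: twin_axiom cnf_vars_php)
  show "{Neg x, Pos (twin x)} \<in> php n"
    using twin_axiom[of "twin x"] x by (simp add: insert_commute cnf_vars_php)
qed (use is_cnf_php twin_neq in auto)

text \<open>Assignments are given by placing exactly one pigeon \<open>f j\<close> in each hole \<open>j\<close>. The set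
  \<open>edges C\<close> is the monotone version of \<open>C\<close>: it consists of the pairs of a pigeon \<open>i\<close> and a hole
  \<open>j\<close> such that placing \<open>i\<close> in \<open>j\<close> satisfies \<open>C\<close>.\<close>

definition place :: "(nat \<Rightarrow> nat) \<Rightarrow> nat \<Rightarrow> bool" where
  "place f x \<longleftrightarrow> f (col x) = row x"

definition edges :: "nat clause \<Rightarrow> (nat \<times> nat) set" where
  "edges C = {(i, j). \<exists>l\<in>C. col (lvar l) = j \<and> holds (place (\<lambda>_. i)) l}"

lemma place_twin [simp]: "place f (twin x) = place f x"
  by (simp add: place_def)

lemma place_pvar [simp]: "place f (pvar i j) \<longleftrightarrow> f j = i"
  by (simp add: place_def)

text \<open>A literal only sees the pigeon in its own column, which is why \<open>edges\<close> can
  test literals on constant placements.\<close>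

lemma holds_place: "holds (place f) l \<longleftrightarrow> holds (place (\<lambda>_. f (col (lvar l)))) l"
  by (cases l) (simp_all add: place_def)

lemma models_place: "models (place f) C \<longleftrightarrow> (\<exists>j. (f j, j) \<in> edges C)"
  unfolding models_def edges_def mem_Collect_eq prod.case using holds_place[of f] by metis

section \<open>The lower bound\<close>

text \<open>Repeatedly place a pigeon in a hole so that the largest possible number of wide clauses is
  satisfied; each placement satisfies a fraction of at least \<open>1/36\<close> of those still unsatisfied.\<close>

lemma greedy_restriction:
  fixes M :: "'c \<Rightarrow> (nat \<times> nat) set"
  assumes T: "finite T" and "t \<le> n"
  shows "\<exists>I J g. I \<subseteq> {..n} \<and> J \<subseteq> {..<n} \<and> card J = n - t \<and> card I = Suc (n - t) \<and>
      g ` ({..<n} - J) = {..n} - I \<and>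
      real (card {C \<in> T. (\<forall>j\<in>{..<n} - J. (g j, j) \<notin> M C) \<and> n * (n + 1) \<le> 36 * card (M C \<inter> I \<times> J)})
        \<le> (35 / 36) ^ t * card T"
  using assms(2)
proof (induction t)
  case 0
  have "card {C \<in> T. (\<forall>j\<in>{..<n} - {..<n}. (undefined j, j) \<notin> M C) \<and>
      n * (n + 1) \<le> 36 * card (M C \<inter> {..n} \<times> {..<n})} \<le> card T"
    using T by (intro card_mono) auto
  then show ?case
    by (intro exI[of _ "{..n}"] exI[of _ "{..<n}"] exI[of _ undefined]) auto
next
  case (Suc t)
  then obtain I J g where I: "I \<subseteq> {..n}" "card I = Suc (n - t)" and J: "J \<subseteq> {..<n}" "card J = n - t"
    and g: "g ` ({..<n} - J) = {..n} - I"
    and le: "real (card {C \<in> T. (\<forall>j\<in>{..<n} - J. (g j, j) \<notin> M C) \<and>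
        n * (n + 1) \<le> 36 * card (M C \<inter> I \<times> J)}) \<le> (35 / 36) ^ t * card T"
    by auto
  define B where "B = {C \<in> T. (\<forall>j\<in>{..<n} - J. (g j, j) \<notin> M C) \<and>
        n * (n + 1) \<le> 36 * card (M C \<inter> I \<times> J)}"
  have finB: "finite B" using T by (simp add: B_def)
  have fin: "finite I" "finite J" using I J finite_subset by blast+
  \<comment> \<open>Double counting: for each clause of \<open>B\<close> at least
    \<open>n * (n + 1) / 36\<close> cells of the grid are good, and the grid has at most
    \<open>n * (n + 1)\<close> cells, so some cell is good for a \<open>1/36\<close> fraction of
    \<open>B\<close>.\<close>
  have "\<exists>e\<in>I \<times> J. card B \<le> 36 * card {C \<in> B. e \<in> M C}"
  proof (rule ccontr)
    assume "\<not> ?thesis"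
    then have less: "\<And>e. e \<in> I \<times> J \<Longrightarrow> 36 * card {C \<in> B. e \<in> M C} < card B"
      by (meson not_le)
    have ne: "I \<times> J \<noteq> {}" using I J Suc.prems by auto
    have "(\<Sum>C\<in>B. 36 * card (M C \<inter> I \<times> J)) = (\<Sum>C\<in>B. \<Sum>e\<in>I \<times> J. if e \<in> M C then 36 else 0)"
      using fin by (intro sum.cong refl) (simp add: sum.If_cases Int_commute)
    also have "\<dots> = (\<Sum>e\<in>I \<times> J. \<Sum>C\<in>B. if e \<in> M C then 36 else 0)"
      by (rule sum.swap)
    also have "\<dots> = (\<Sum>e\<in>I \<times> J. 36 * card {C \<in> B. e \<in> M C})"
      using finB by (intro sum.cong refl) (simp add: sum.If_cases Int_def)
    also have "\<dots> < (\<Sum>e\<in>I \<times> J. card B)"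
      using less ne fin by (intro sum_strict_mono) auto
    also have "\<dots> = card I * card J * card B"
      by (simp add: card_cartesian_product)
    also have "\<dots> \<le> (n + 1) * n * card B"
      using I J by (intro mult_mono) auto
    also have "\<dots> = (\<Sum>C\<in>B. n * (n + 1))" by simp
    also have "\<dots> \<le> (\<Sum>C\<in>B. 36 * card (M C \<inter> I \<times> J))"
      by (intro sum_mono) (simp add: B_def)
    finally show False by simp
  qed
  then obtain i j where ij: "i \<in> I" "j \<in> J" and many: "card B \<le> 36 * card {C \<in> B. (i, j) \<in> M C}"
    by auto
  let ?I = "I - {i}" and ?J = "J - {j}" and ?g = "g(j := i)"
  define B' where "B' = {C \<in> T. (\<forall>k\<in>{..<n} - ?J. (?g k, k) \<notin> M C) \<and>
        n * (n + 1) \<le> 36 * card (M C \<inter> ?I \<times> ?J)}"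
  \<comment> \<open>The width threshold refers to \<open>n\<close> and not to the shrinking grid, so
    a clause counted after the placement was also counted before it.\<close>
  have "B' \<subseteq> B - {C \<in> B. (i, j) \<in> M C}"
  proof
    fix C assume C: "C \<in> B'"
    have 1: "(?g k, k) \<notin> M C" if "k \<in> {..<n} - ?J" for k
      using C that unfolding B'_def by blast
    have "j \<in> {..<n} - ?J" using ij J by auto
    from 1[OF this] have "(i, j) \<notin> M C" by simp
    moreover have "(g k, k) \<notin> M C" if "k \<in> {..<n} - J" for k
      using 1[of k] that ij by (cases "k = j") auto
    moreover have "card (M C \<inter> ?I \<times> ?J) \<le> card (M C \<inter> I \<times> J)"
      using fin by (intro card_mono) auto
    ultimately show "C \<in> B - {C \<in> B. (i, j) \<in> M C}"
      using C by (auto simp: B'_def B_def)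
  qed
  then have "card B' \<le> card (B - {C \<in> B. (i, j) \<in> M C})"
    using finB by (intro card_mono) auto
  also have "\<dots> = card B - card {C \<in> B. (i, j) \<in> M C}"
    using finB by (intro card_Diff_subset) auto
  finally have "card B' + card {C \<in> B. (i, j) \<in> M C} \<le> card B"
    using card_mono[OF finB, of "{C \<in> B. (i, j) \<in> M C}"] by auto
  then have "36 * real (card B') \<le> 35 * real (card B)"
    using many by linarith
  also have "\<dots> \<le> 35 * ((35 / 36) ^ t * card T)"
    using le unfolding B_def by (intro mult_left_mono) simp_all
  finally have "real (card B') \<le> (35 / 36) ^ Suc t * card T" by simp
  moreover have "?g ` ({..<n} - ?J) = {..n} - ?I"
  proof -
    have "{..<n} - ?J = insert j ({..<n} - J)" using ij J by auto
    moreover have "?g ` ({..<n} - J) = g ` ({..<n} - J)"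
      using ij by (intro image_cong) auto
    ultimately show ?thesis using g ij I by auto
  qed
  moreover have "card ?J = n - Suc t" "card ?I = Suc (n - Suc t)"
    using I J ij fin Suc.prems by auto
  moreover have "?I \<subseteq> {..n}" "?J \<subseteq> {..<n}" using I J by auto
  ultimately show ?case
    unfolding B'_def by blast
qed

text \<open>The argument of Beame and Pitassi. After the greedy restriction, the pigeons in \<open>I\<close> and the
  holes in \<open>J\<close> are left. The progress of a clause is the number of pigeons \<open>i \<in> I\<close> such that some
  placement missing only \<open>i\<close> falsifies it. Progress is subadditive, at most \<open>1\<close> on the axioms and
  \<open>card I\<close> on the empty clause. Swapping the missing pigeon shows that a clause of medium progress
  is wide.\<close>

lemma derivable_php_size:
  assumes fin: "finite T" and der: "{} \<in> derivable twin T (php n)" and n: "4 \<le> n"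
  shows "1 \<le> (35 / 36) ^ (n div 2) * real (card T)"
proof (rule ccontr)
  assume small: "\<not> ?thesis"
  obtain I J g where I: "I \<subseteq> {..n}" "card I = Suc (n - n div 2)"
    and J: "J \<subseteq> {..<n}" "card J = n - n div 2"
    and g: "g ` ({..<n} - J) = {..n} - I"
    and le: "real (card {C \<in> T. (\<forall>j\<in>{..<n} - J. (g j, j) \<notin> edges C) \<and>
        n * (n + 1) \<le> 36 * card (edges C \<inter> I \<times> J)}) \<le> (35 / 36) ^ (n div 2) * card T"
    using greedy_restriction[OF fin, of "n div 2" n edges] by auto
  define B where "B = {C \<in> T. (\<forall>j\<in>{..<n} - J. (g j, j) \<notin> edges C) \<and>
        n * (n + 1) \<le> 36 * card (edges C \<inter> I \<times> J)}"
  have "real (card B) < 1"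
    using le small unfolding B_def by linarith
  moreover have "finite B" using fin by (simp add: B_def)
  ultimately have "B = {}" by simp
  then have none: False if "C \<in> T" "\<And>j. j \<in> {..<n} - J \<Longrightarrow> (g j, j) \<notin> edges C"
    "n * (n + 1) \<le> 36 * card (edges C \<inter> I \<times> J)" for C
    using that unfolding B_def by blast
  have finIJ: "finite I" "finite J" using I J finite_subset by blast+
  define critical where "critical i f \<longleftrightarrow> bij_betw f J (I - {i}) \<and> (\<forall>j. j \<notin> J \<longrightarrow> f j = g j)" for i f
  define progress where "progress C = {i \<in> I. \<exists>f. critical i f \<and> \<not> models (place f) C}" for C
  define a where "a = card I"
  \<comment> \<open>Progress \<open>p\<close> with \<open>K < p\<close> and
    \<open>p \<le> 2 * K\<close> makes both \<open>p\<close> and \<open>a - p\<close> at least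
    \<open>a / 3\<close>.\<close>
  define K where "K = a div 3"
  have fin_progress: "finite (progress C)" and progress_le: "card (progress C) \<le> a" for C
    using finIJ by (auto simp: progress_def a_def intro: card_mono)
  have a: "n + 2 \<le> 2 * a" "3 \<le> a" using I n unfolding a_def by auto
  have covered: "k \<in> f ` {..<n}" if crit: "critical i f" "k \<le> n" "k \<noteq> i" for i f k
  proof (cases "k \<in> I")
    case True
    then have "k \<in> f ` J" using crit by (auto simp: critical_def bij_betw_def)
    then show ?thesis using J by auto
  next
    case False
    then obtain j where "j \<in> {..<n} - J" "k = g j" using g crit(2) by (auto simp: set_eq_iff image_iff)
    moreover from this have "f j = g j" using crit(1) by (simp add: critical_def)
    ultimately show ?thesis by (metis DiffD1 imageI)
  qed
  have wide: False if C: "C \<in> T" and mid: "K < card (progress C)" "card (progress C) \<le> 2 * K" for C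
  proof (rule none[OF C])
    obtain i0 f0 where f0: "critical i0 f0" "\<not> models (place f0) C"
    proof -
      have "progress C \<noteq> {}" using mid by auto
      then show ?thesis using that unfolding progress_def by blast
    qed
    show "(g j, j) \<notin> edges C" if "j \<in> {..<n} - J" for j
    proof -
      have "f0 j = g j" using f0(1) that by (simp add: critical_def)
      then show ?thesis using f0(2) unfolding models_place by metis
    qed
    \<comment> \<open>Move the missing pigeon \<open>i\<close> into the hole \<open>j\<close> of
      \<open>k\<close>. The new placement misses \<open>k\<close>, hence satisfies the clause, and
      it differs from \<open>f\<close> only in hole \<open>j\<close>, so \<open>(i, j)\<close> is an
      edge. For fixed \<open>i\<close> and \<open>f\<close>, distinct \<open>k\<close> give distinct
      \<open>j\<close>.\<close>
    have "\<exists>j\<in>J. (i, j) \<in> edges C \<and> f j = k"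
      if f: "critical i f" "\<not> models (place f) C" and i: "i \<in> I" and k: "k \<in> I - progress C" for i f k
    proof -
      have "k \<noteq> i" using f i k by (auto simp: progress_def)
      then have "k \<in> f ` J" using f(1) k by (auto simp: critical_def bij_betw_def)
      then obtain j where j: "j \<in> J" "f j = k" by auto
      let ?f = "f(j := i)"
      have "bij_betw ?f J (I - {k})"
        unfolding bij_betw_def
      proof
        have inj: "inj_on f J" "f ` J = I - {i}" using f(1) by (auto simp: critical_def bij_betw_def)
        then show "inj_on ?f J" by (auto simp: inj_on_def)
        have "?f ` J = insert i (f ` (J - {j}))" using j by auto
        also have "f ` (J - {j}) = I - {i} - {k}"
          using inj j by (simp add: inj_on_image_set_diff[of f J])
        finally show "?f ` J = I - {k}" using i \<open>k \<noteq> i\<close> by auto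
      qed
      then have "critical k ?f" using f(1) j by (auto simp: critical_def)
      then have "models (place ?f) C" using k by (auto simp: progress_def)
      then obtain j' where j': "(?f j', j') \<in> edges C" by (auto simp: models_place)
      then have "j' = j" using f(2) by (auto simp: models_place split: if_splits)
      then show ?thesis using j' j by auto
    qed
    then have "\<forall>i\<in>progress C. \<exists>f. \<forall>k\<in>I - progress C. \<exists>j\<in>J. (i, j) \<in> edges C \<and> f j = k"
      unfolding progress_def by blast
    then obtain F where F: "\<And>i k. i \<in> progress C \<Longrightarrow> k \<in> I - progress C \<Longrightarrow>
        \<exists>j\<in>J. (i, j) \<in> edges C \<and> F i j = k"
      by metis
    have "progress C \<times> (I - progress C) \<subseteq> (\<lambda>(i, j). (i, F i j)) ` (edges C \<inter> I \<times> J)"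
      using F unfolding progress_def by fastforce
    then have "card (progress C \<times> (I - progress C)) \<le> card (edges C \<inter> I \<times> J)"
      using finIJ by (intro surj_card_le) auto
    moreover have "card (I - progress C) = a - card (progress C)"
      using fin_progress by (subst card_Diff_subset) (auto simp: progress_def a_def)
    ultimately have "card (progress C) * (a - card (progress C)) \<le> card (edges C \<inter> I \<times> J)"
      by (simp add: card_cartesian_product)
    \<comment> \<open>The constant 36 arises here: a factor 9 from the two thirds, and a factor 4
      from \<open>n + 1 < 2 * a\<close>.\<close>
    moreover have "a * a \<le> (3 * card (progress C)) * (3 * (a - card (progress C)))"
      using mid unfolding K_def by (intro mult_mono) auto
    moreover have "n * (n + 1) \<le> (2 * a) * (2 * a)"
      using a by (intro mult_mono) auto
    ultimately show "n * (n + 1) \<le> 36 * card (edges C \<inter> I \<times> J)"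
      by auto
  qed
  have "card (progress C) \<le> K" if "C \<in> derivable twin T (php n)" for C
    using that
  proof induction
    case (axiom D)
    then consider i where "i \<le> n" "D = pigeon_clause n i"
      | x y where "col x = col y" "row x \<noteq> row y" "D = {Neg x, Neg y}"
      | x where "D = {Pos x, Neg (twin x)}"
      by (auto simp: php_def)
    \<comment> \<open>Hole and twin axioms hold in every placement, and a pigeon clause fails only
      if its own pigeon is missing.\<close>
    then have "\<exists>i. progress D \<subseteq> {i}"
    proof cases
      case (1 i)
      have "models (place f) D" if "critical k f" "k \<noteq> i" for k f
        using covered[OF that(1) 1(1)] that(2) 1(2) by (force simp: models_def pigeon_clause_def)
      then show ?thesis unfolding progress_def by blast
    next
      case 2
      then have "models (place f) D" for f by (auto simp: models_def place_def)
      then show ?thesis unfolding progress_def by blast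
    next
      case 3
      then have "models (place f) D" for f by (auto simp: models_def)
      then show ?thesis unfolding progress_def by blast
    qed
    then obtain i where "progress D \<subseteq> {i}" by blast
    then have "card (progress D) \<le> 1" using card_mono[of "{i}" "progress D"] by simp
    then show ?case using a by (simp add: K_def)
  next
    case (step E F G)
    have "progress G \<subseteq> progress E \<union> progress F"
      using step.hyps(4) by (auto simp: twin_entails_def progress_def)
    then have "card (progress G) \<le> card (progress E) + card (progress F)"
      by (meson card_Un_le card_mono fin_progress finite_UnI order_trans)
    \<comment> \<open>Subadditivity gives at most \<open>2 * K\<close>, and \<open>wide\<close>
      rules out everything above \<open>K\<close>.\<close>
    then show ?case using wide[OF step.hyps(3)] step.IH by force
  qed
  then have "card (progress {}) \<le> K" using der by blast
  moreover have "progress {} = I"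
  proof -
    have "\<exists>f. critical i f" if i: "i \<in> I" for i
    proof -
      have "card J = card (I - {i})" using finIJ I J i by simp
      then obtain f where "bij_betw f J (I - {i})"
        using finite_same_card_bij[of J "I - {i}"] finIJ by auto
      then have "critical i (\<lambda>j. if j \<in> J then f j else g j)"
        by (auto simp: critical_def cong: bij_betw_cong)
      then show ?thesis by blast
    qed
    then show ?thesis by (auto simp: progress_def models_def)
  qed
  ultimately show False using a by (simp add: K_def a_def)
qed

lemma rat_minus_php_size:
  assumes "rat_minus_proof (php n) \<Delta>s" "4 \<le> n"
  shows "(36 / 35) ^ (n div 2) \<le> real (length \<Delta>s) * (2 * (real n * (real n + 1)) + 2)"
proof -
  obtain T where T: "finite T" "card T \<le> length \<Delta>s * (card (php_vars n) + 2)"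
    "{} \<in> derivable twin T (php n)"
    using twins.rat_minus_proof_derivable[OF twins_php assms(1)] by (auto simp: cnf_vars_php)
  have "(36 / 35) ^ (n div 2) * 1 \<le> (36 / 35) ^ (n div 2) * ((35 / 36) ^ (n div 2) * real (card T))"
    using derivable_php_size[OF T(1,3) assms(2)] by (intro mult_left_mono) auto
  also have "\<dots> = real (card T)"
    by (simp flip: mult.assoc power_mult_distrib)
  also have "\<dots> \<le> real (length \<Delta>s * (2 * (n * (n + 1)) + 2))"
  proof -
    have "length \<Delta>s * (card (php_vars n) + 2) \<le> length \<Delta>s * (2 * (n * (n + 1)) + 2)"
      using card_php_vars[of n] by (intro mult_left_mono add_right_mono) auto
    then show ?thesis using T(2) by linarith
  qed
  finally show ?thesis by (simp add: algebra_simps)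
qed

lemma rat_minus_php_exponential:
  "\<exists>\<epsilon> > 0 :: real. \<forall>\<^sub>F n in sequentially.
     \<forall>\<Delta>s. rat_minus_proof (php n) \<Delta>s \<longrightarrow> real (length \<Delta>s) \<ge> 2 powr (\<epsilon> * real n)"
proof -
  define c :: real where "c = 36 / 35"
  \<comment> \<open>The available exponent is about \<open>n / 2\<close>; half of it absorbs the
    polynomial factor.\<close>
  define \<epsilon> where "\<epsilon> = log 2 c / 4"
  have c: "c > 1" by (simp add: c_def)
  \<comment> \<open>The \<open>- 1\<close> pays for the rounding in \<open>n div 2\<close>.\<close>
  have ev: "\<forall>\<^sub>F n in sequentially. c powr (real n / 4) * (2 * (real n * (real n + 1)) + 2) \<le> c powr (real n / 2 - 1)"
    using c by real_asymp
  have "\<forall>\<^sub>F n in sequentially. \<forall>\<Delta>s. rat_minus_proof (php n) \<Delta>s \<longrightarrow> real (length \<Delta>s) \<ge> 2 powr (\<epsilon> * real n)"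
    using ev eventually_ge_at_top[of 4]
  proof eventually_elim
    case (elim n)
    have "2 powr (\<epsilon> * real n) = (2 powr log 2 c) powr (real n / 4)"
      by (simp add: powr_powr \<epsilon>_def)
    then have eq: "2 powr (\<epsilon> * real n) = c powr (real n / 4)" using c by simp
    show ?case
    proof (intro allI impI)
      fix \<Delta>s assume pf: "rat_minus_proof (php n) \<Delta>s"
      let ?p = "2 * (real n * (real n + 1)) + 2"
      have "c powr (real n / 4) * ?p \<le> c powr (real n / 2 - 1)" by (rule elim)
      also have "\<dots> \<le> c powr real (n div 2)"
        using c by (intro powr_mono) linarith+
      also have "\<dots> = c ^ (n div 2)" using c by (simp add: powr_realpow)
      also have "\<dots> \<le> real (length \<Delta>s) * ?p"
        using rat_minus_php_size[OF pf] elim by (simp add: c_def)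
      finally have "c powr (real n / 4) * ?p \<le> real (length \<Delta>s) * ?p" .
      moreover have "?p > 0" by (intro add_nonneg_pos) auto
      ultimately show "real (length \<Delta>s) \<ge> 2 powr (\<epsilon> * real n)"
        unfolding eq by (simp only: mult_le_cancel_right_pos)
    qed
  qed
  moreover have "\<epsilon> > 0" using c by (simp add: \<epsilon>_def)
  ultimately show ?thesis by blast
qed

section \<open>Building SBC proofs\<close>

text \<open>The rule \<open>refl\<close> is available for each \<open>b\<close>, so \<open>b\<close> is only an upper bound on the number of
  steps.\<close>

inductive reach :: "'v set \<Rightarrow> nat \<Rightarrow> 'v cnf \<Rightarrow> 'v cnf \<Rightarrow> bool" for X where
  refl: "reach X b \<Delta> \<Delta>"
| step: "reach X b \<Delta> \<Delta>' \<Longrightarrow> resolution_rule \<Delta>' C \<or> sbc \<Delta>' C \<Longrightarrow> is_clause C \<Longrightarrow> lvar ` C \<subseteq> X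
    \<Longrightarrow> reach X (Suc b) \<Delta> (insert C \<Delta>')"

lemma reach_mono: "reach X b \<Delta> \<Delta>' \<Longrightarrow> b \<le> b' \<Longrightarrow> reach X b' \<Delta> \<Delta>'"
proof (induction arbitrary: b' rule: reach.induct)
  case (step b \<Delta> \<Delta>' C)
  then obtain c where "b' = Suc c" "b \<le> c" by (metis Suc_le_D Suc_le_mono)
  then show ?case using step by (auto intro: reach.step)
qed (rule reach.refl)

lemma reach_subset: "reach X b \<Delta> \<Delta>' \<Longrightarrow> \<Delta> \<subseteq> \<Delta>'"
  by (induction rule: reach.induct) auto

lemma reach_trans: "reach X b' \<Delta>' \<Delta>'' \<Longrightarrow> reach X b \<Delta> \<Delta>' \<Longrightarrow> reach X (b + b') \<Delta> \<Delta>''"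
  by (induction rule: reach.induct) (auto intro: reach.step reach_mono)

lemma reach_sbc_proof:
  assumes "reach X b \<Gamma> \<Delta>" "is_cnf \<Gamma>" "cnf_vars \<Gamma> = X" "{} \<in> \<Delta>"
  shows "\<exists>\<Delta>s. sbc_minus_proof \<Gamma> \<Delta>s \<and> length \<Delta>s \<le> Suc b"
proof -
  have "\<exists>\<Delta>s. \<Delta>s \<noteq> [] \<and> (\<forall>\<Delta>\<in>set \<Delta>s. is_cnf \<Delta> \<and> cnf_vars \<Delta> \<subseteq> X) \<and> hd \<Delta>s = \<Gamma> \<and> last \<Delta>s = \<Delta> \<and>
      length \<Delta>s \<le> Suc b \<and>
      (\<forall>i. Suc i < length \<Delta>s \<longrightarrow>
        (\<exists>C. (resolution_rule (\<Delta>s ! i) C \<or> sbc (\<Delta>s ! i) C) \<and> \<Delta>s ! Suc i = \<Delta>s ! i \<union> {C}))"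
    (is "\<exists>\<Delta>s. ?P \<Delta>s")
    using assms(1,2,3)
  proof (induction rule: reach.induct)
    case (refl b \<Delta>)
    then show ?case by (intro exI[of _ "[\<Delta>]"]) auto
  next
    case (step b \<Delta> \<Delta>' C)
    then obtain \<Delta>s where \<Delta>s: "\<Delta>s \<noteq> []" "\<forall>\<Delta>\<in>set \<Delta>s. is_cnf \<Delta> \<and> cnf_vars \<Delta> \<subseteq> X" "hd \<Delta>s = \<Delta>"
      "last \<Delta>s = \<Delta>'" "length \<Delta>s \<le> Suc b"
      and rule: "\<And>i. Suc i < length \<Delta>s \<Longrightarrow>
        \<exists>C. (resolution_rule (\<Delta>s ! i) C \<or> sbc (\<Delta>s ! i) C) \<and> \<Delta>s ! Suc i = \<Delta>s ! i \<union> {C}"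
      by blast
    have "is_cnf \<Delta>'" "cnf_vars \<Delta>' \<subseteq> X" using \<Delta>s by force+
    then have 1: "is_cnf (insert C \<Delta>')" "cnf_vars (insert C \<Delta>') \<subseteq> X"
      using step.hyps by (auto simp: is_cnf_def cnf_vars_def)
    have 2: "\<exists>D. (resolution_rule ((\<Delta>s @ [insert C \<Delta>']) ! i) D \<or> sbc ((\<Delta>s @ [insert C \<Delta>']) ! i) D) \<and>
        (\<Delta>s @ [insert C \<Delta>']) ! Suc i = (\<Delta>s @ [insert C \<Delta>']) ! i \<union> {D}"
      if "Suc i < length (\<Delta>s @ [insert C \<Delta>'])" for i
    proof (cases "Suc i < length \<Delta>s")
      case True
      then show ?thesis using rule by (simp add: nth_append)
    next
      case False
      then have i: "i = length \<Delta>s - 1" "length \<Delta>s \<noteq> 0" using that \<Delta>s(1) by auto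
      then have "(\<Delta>s @ [insert C \<Delta>']) ! i = \<Delta>'" "(\<Delta>s @ [insert C \<Delta>']) ! Suc i = insert C \<Delta>'"
        using \<Delta>s(1,4) by (simp_all add: nth_append last_conv_nth)
      then show ?thesis using step.hyps(2) by auto
    qed
    show ?case
      using \<Delta>s 1 2 by (intro exI[of _ "\<Delta>s @ [insert C \<Delta>']"] conjI) auto
  qed
  then obtain \<Delta>s where "?P \<Delta>s" ..
  then have "sbc_minus_proof \<Gamma> \<Delta>s \<and> length \<Delta>s \<le> Suc b"
    using assms(3,4)
    by (simp add: sbc_minus_proof_def sbc_proof_def is_proof_def no_new_vars_def)
  then show ?thesis ..
qed

lemma sbc_antimono:
  assumes "sbc \<Delta>' C" "\<Delta> \<subseteq> \<Delta>'"
  shows "sbc \<Delta> C"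
proof -
  obtain L where "sbc_for L \<Delta>' C" using assms(1) unfolding sbc_def ..
  then have "sbc_for L \<Delta> C" using subsetD[OF assms(2)] by (simp add: sbc_for_def)
  then show ?thesis unfolding sbc_def ..
qed

lemma sbc_is_clause: "sbc \<Delta> C \<Longrightarrow> is_clause C"
  unfolding sbc_def sbc_for_def by (elim exE conjE)

text \<open>Blockedness passes to subsets of the CNF, so clauses blocked with respect to the final
  CNF can be added in any order.\<close>

lemma reach_sbcs:
  assumes "finite S" "\<And>C. C \<in> S \<Longrightarrow> sbc (\<Delta> \<union> S) C \<and> lvar ` C \<subseteq> X"
  shows "reach X (card S) \<Delta> (\<Delta> \<union> S)"
proof -
  have "reach X (card T) \<Delta> (\<Delta> \<union> T)" if "T \<subseteq> S" for T
    using finite_subset[OF that assms(1)] that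
  proof (induction T rule: finite_induct)
    case empty
    then show ?case by (simp add: reach.refl)
  next
    case (insert C T)
    have "sbc (\<Delta> \<union> T) C"
      using insert.prems assms(2)[of C] by (blast intro: sbc_antimono[of "\<Delta> \<union> S"])
    moreover have "reach X (card T) \<Delta> (\<Delta> \<union> T)"
      using insert.IH insert.prems by simp
    ultimately have "reach X (Suc (card T)) \<Delta> (insert C (\<Delta> \<union> T))"
      using insert.prems assms(2)[of C] by (simp add: reach.step sbc_is_clause)
    then show ?case using insert.hyps by simp
  qed
  then show ?thesis by simp
qed

text \<open>Unlike SBC steps, resolution steps remain valid when clauses are added. The quantification over
  \<open>\<Delta>'\<close> keeps only such derivations, which can be composed freely.\<close>

definition provable :: "'v set \<Rightarrow> nat \<Rightarrow> 'v cnf \<Rightarrow> 'v cnf \<Rightarrow> bool" where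
  "provable X b \<Delta> S \<longleftrightarrow> (\<forall>\<Delta>'. \<Delta> \<subseteq> \<Delta>' \<longrightarrow> (\<exists>\<Delta>''. reach X b \<Delta>' \<Delta>'' \<and> S \<subseteq> \<Delta>''))"

lemma provable_mono: "provable X b \<Delta> S \<Longrightarrow> b \<le> b' \<Longrightarrow> \<Delta> \<subseteq> \<Delta>' \<Longrightarrow> S' \<subseteq> S \<Longrightarrow> provable X b' \<Delta>' S'"
  unfolding provable_def by (meson order_trans reach_mono)

lemma provable_step:
  assumes "\<And>\<Delta>'. \<Delta> \<subseteq> \<Delta>' \<Longrightarrow> resolution_rule \<Delta>' C" "is_clause C" "lvar ` C \<subseteq> X"
  shows "provable X (Suc b) \<Delta> {C}"
  unfolding provable_def
proof (intro allI impI)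
  fix \<Delta>' assume "\<Delta> \<subseteq> \<Delta>'"
  then have "reach X (Suc b) \<Delta>' (insert C \<Delta>')"
    using assms by (blast intro: reach.step[OF reach.refl])
  then show "\<exists>\<Delta>''. reach X (Suc b) \<Delta>' \<Delta>'' \<and> {C} \<subseteq> \<Delta>''" by blast
qed

lemma provable_trans:
  assumes "provable X b \<Delta> S" "provable X b' (\<Delta> \<union> S) S'"
  shows "provable X (b + b') \<Delta> (S \<union> S')"
  unfolding provable_def
proof (intro allI impI)
  fix \<Delta>1 assume 1: "\<Delta> \<subseteq> \<Delta>1"
  then obtain \<Delta>2 where 2: "reach X b \<Delta>1 \<Delta>2" "S \<subseteq> \<Delta>2"
    using assms(1) unfolding provable_def by blast
  then have "\<Delta> \<union> S \<subseteq> \<Delta>2" using 1 reach_subset by blast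
  then obtain \<Delta>3 where 3: "reach X b' \<Delta>2 \<Delta>3" "S' \<subseteq> \<Delta>3"
    using assms(2) unfolding provable_def by blast
  then show "\<exists>\<Delta>''. reach X (b + b') \<Delta>1 \<Delta>'' \<and> S \<union> S' \<subseteq> \<Delta>''"
    using 2 reach_trans[OF 3(1) 2(1)] reach_subset[OF 3(1)] by blast
qed

lemma provable_image:
  assumes "finite A" "\<And>a. a \<in> A \<Longrightarrow> provable X b \<Delta> {f a}"
  shows "provable X (card A * b) \<Delta> (f ` A)"
  using assms
proof (induction A rule: finite_induct)
  case empty
  then show ?case by (auto simp: provable_def intro: reach.refl)
next
  case (insert a A)
  have "provable X b (\<Delta> \<union> f ` A) {f a}"
    using insert.prems by (intro provable_mono[OF insert.prems]) auto
  then have "provable X (card A * b + b) \<Delta> (f ` A \<union> {f a})"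
    using insert by (intro provable_trans) auto
  then show ?case using insert.hyps by (simp add: add.commute)
qed

lemma resolve_clause:
  assumes "P \<in> \<Delta>" "Q \<in> \<Delta>" "l \<in> P" "compl l \<in> Q" "is_clause P" "is_clause Q"
    and C: "C = (P - {l}) \<union> (Q - {compl l})" "is_clause C"
  shows "resolution_rule \<Delta> C"
proof -
  have P: "lvar l \<notin> lvar ` (P - {l})"
    using assms(3,5) by (auto simp: mem_lvar_image is_clause_def tautological_iff)
  have Q: "lvar l \<notin> lvar ` (Q - {compl l})"
    using assms(4,6) by (auto simp: mem_lvar_image is_clause_def tautological_iff)
  have eqs: "P = (P - {l}) \<union> {l}" "Q = (Q - {compl l}) \<union> {compl l}" using assms by auto
  show ?thesis
  proof (cases l)
    case (Pos x)
    then have "resolvent P Q C"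
      unfolding resolvent_def using P Q eqs assms(5,6) C
      by (intro exI[of _ x] exI[of _ "P - {l}"] exI[of _ "Q - {compl l}"]) simp
    then show ?thesis using assms(1,2) by (auto simp: resolution_rule_def)
  next
    case (Neg x)
    then have "resolvent Q P C"
      unfolding resolvent_def using P Q eqs assms(5,6) C
      by (intro exI[of _ x] exI[of _ "Q - {compl l}"] exI[of _ "P - {l}"]) auto
    then show ?thesis using assms(1,2) by (auto simp: resolution_rule_def)
  qed
qed

text \<open>The literals of \<open>U\<close> are resolved away one at a time. Side premises bring in
  only literals of \<open>A\<close>, and a final weakening restores all of \<open>A\<close>.\<close>

lemma provable_hyperresolution:
  assumes "finite U" "E \<in> \<Delta>" "E \<subseteq> A \<union> U" "is_clause (A \<union> U)" "lvar ` (A \<union> U) \<subseteq> X"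
    and "\<And>l. l \<in> U \<Longrightarrow> l \<notin> A \<and> (\<exists>D\<in>\<Delta>. compl l \<in> D \<and> D \<subseteq> insert (compl l) A \<and> is_clause D)"
  shows "provable X (Suc (card U)) \<Delta> {A}"
  using assms
proof (induction U arbitrary: E \<Delta> rule: finite_induct)
  case empty
  then have A: "is_clause A" by simp
  moreover have "\<exists>B. A = E \<union> B" using empty by auto
  ultimately have "resolution_rule \<Delta>' A" if "\<Delta> \<subseteq> \<Delta>'" for \<Delta>'
    using empty that by (auto simp: resolution_rule_def weakening_def)
  then show ?case
    using empty(4) A by (intro provable_step) auto
next
  case (insert l U)
  show ?case
  proof (cases "l \<in> E")
    case False
    have "provable X (Suc (card U)) \<Delta> {A}"
      using insert.prems False by (intro insert.IH[of E]) (auto intro: is_clause_subset)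
    then show ?thesis by (rule provable_mono) (use insert.hyps in auto)
  next
    case True
    obtain D where D: "D \<in> \<Delta>" "compl l \<in> D" "D \<subseteq> insert (compl l) A" "is_clause D"
      using insert.prems(5)[of l] by blast
    define G where "G = (E - {l}) \<union> (D - {compl l})"
    have G: "G \<subseteq> A \<union> U" using insert.prems(2) D(3) by (auto simp: G_def)
    have clause: "is_clause (A \<union> U)" "is_clause E" "is_clause G"
      using insert.prems(2,3) G by (auto intro: is_clause_subset)
    have "resolution_rule \<Delta>' G" if "\<Delta> \<subseteq> \<Delta>'" for \<Delta>'
      using resolve_clause[of E \<Delta>' D l G] that insert.prems(1) D True clause by (auto simp: G_def)
    then have 1: "provable X (Suc 0) \<Delta> {G}"
      using clause G insert.prems(4) by (intro provable_step) auto
    have "provable X (Suc (card U)) (\<Delta> \<union> {G}) {A}"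
      using insert.prems G clause by (intro insert.IH[of G]) auto
    from provable_trans[OF 1 this] show ?thesis
      by (rule provable_mono) (use insert.hyps in auto)
  qed
qed

section \<open>Short SBC proofs of the doubled pigeonhole principle\<close>

text \<open>Exchanging the contents of two holes \<open>j < h\<close> preserves all axioms once both columns are
  completely specified. So a set-blocked clause can exclude the case that hole \<open>j\<close> contains pigeon
  \<open>h + 1\<close> and hole \<open>h\<close> contains pigeon \<open>i \<le> h\<close>.\<close>

definition before :: "nat \<Rightarrow> nat \<Rightarrow> nat \<Rightarrow> nat \<Rightarrow> nat" where
  "before h i j c = (if c = j then Suc h else i)"

definition after :: "nat \<Rightarrow> nat \<Rightarrow> nat \<Rightarrow> nat \<Rightarrow> nat" where
  "after h i j c = (if c = j then i else Suc h)"

definition swap_clause :: "nat \<Rightarrow> nat \<Rightarrow> nat \<Rightarrow> nat \<Rightarrow> nat clause" where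
  "swap_clause n h i j =
     {l. row (lvar l) \<le> n \<and> col (lvar l) \<in> {j, h} \<and> \<not> holds (place (before h i j)) l}"

definition swap_clauses :: "nat \<Rightarrow> nat \<Rightarrow> nat cnf" where
  "swap_clauses n m = {swap_clause n h i j | h i j. m \<le> h \<and> h < n \<and> i \<le> h \<and> j < h}"

lemma lvar_swap_clause: "j < n \<Longrightarrow> h < n \<Longrightarrow> lvar ` swap_clause n h i j \<subseteq> php_vars n"
  by (auto simp: swap_clause_def php_vars_def)

lemma is_clause_swap_clause: "j < n \<Longrightarrow> h < n \<Longrightarrow> is_clause (swap_clause n h i j)"
  using lvar_image_finite[OF finite_php_vars lvar_swap_clause]
  by (auto simp: is_clause_def tautological_iff swap_clause_def)

text \<open>\<open>L\<close> consists of the literals that the swap makes true. A touched clause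
  with a literal \<open>l\<close> true after the swap either meets \<open>L\<close> or clashes on
  \<open>l\<close>: then \<open>l\<close> is not in the swap clause, so \<open>compl l\<close> is,
  and the swap does not make \<open>compl l\<close> true.\<close>

lemma sbc_swap_clause:
  assumes "h < n" "i \<le> h" "j < h"
    and sat: "\<And>D x. D \<in> \<Delta> \<Longrightarrow> row x \<le> n \<Longrightarrow> col x \<in> {j, h} \<Longrightarrow>
        Pos x \<in> D \<and> place (before h i j) x \<or> Neg x \<in> D \<Longrightarrow>
        \<exists>l\<in>D. row (lvar l) \<le> n \<and> col (lvar l) \<in> {j, h} \<and> holds (place (after h i j)) l"
  shows "sbc \<Delta> (swap_clause n h i j)"
proof -
  let ?C = "swap_clause n h i j"
  define L where "L = {l \<in> ?C. holds (place (after h i j)) l}"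
  have "Pos (pvar i j) \<in> L"
    using assms by (auto simp: L_def swap_clause_def before_def after_def)
  moreover have "tautological ((?C - L) \<union> (D - compl ` L))"
    if D: "D \<in> \<Delta>" "D \<inter> compl ` L \<noteq> {}" "D \<inter> L = {}" for D
  proof -
    obtain k where k: "k \<in> L" "compl k \<in> D" using D(2) by auto
    have "\<exists>l\<in>D. row (lvar l) \<le> n \<and> col (lvar l) \<in> {j, h} \<and> holds (place (after h i j)) l"
      using D(1) k by (intro sat[of D "lvar k"]; cases k) (auto simp: L_def swap_clause_def)
    then obtain l where l: "l \<in> D" "row (lvar l) \<le> n" "col (lvar l) \<in> {j, h}" "holds (place (after h i j)) l"
      by blast
    then have "l \<notin> ?C" using D(3) by (auto simp: L_def)
    then have "compl l \<in> ?C - L" using l by (auto simp: L_def swap_clause_def)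
    moreover have "l \<in> D - compl ` L" using l by (auto simp: mem_compl_image L_def)
    ultimately show ?thesis unfolding tautological_iff by (metis UnI1 UnI2)
  qed
  ultimately show ?thesis
    using is_clause_swap_clause[of j n h i] assms unfolding sbc_def sbc_for_def
    by (intro exI[of _ L]) (auto simp: L_def)
qed

lemma sbc_swap_clauses:
  assumes h: "h < n" "i \<le> h" "j < h"
  shows "sbc (php n \<union> swap_clauses n h) (swap_clause n h i j)"
proof (rule sbc_swap_clause[OF h])
  fix D x
  assume D: "D \<in> php n \<union> swap_clauses n h" and x: "row x \<le> n" "col x \<in> {j, h}"
    "Pos x \<in> D \<and> place (before h i j) x \<or> Neg x \<in> D"
  let ?sat = "\<lambda>l. l \<in> D \<and> row (lvar l) \<le> n \<and> col (lvar l) \<in> {j, h} \<and> holds (place (after h i j)) l"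
  from D consider k where "k \<le> n" "D = pigeon_clause n k"
    | y z where "y \<in> php_vars n" "z \<in> php_vars n" "col y = col z" "row y \<noteq> row z" "D = {Neg y, Neg z}"
    | y where "y \<in> php_vars n" "D = {Pos y, Neg (twin y)}"
    | h' i' j' where "h \<le> h'" "h' < n" "i' \<le> h'" "j' < h'" "D = swap_clause n h' i' j'"
    unfolding php_def swap_clauses_def by blast
  then have "\<exists>l. ?sat l"
  proof cases
    case (1 k)
    then have "place (before h i j) x" "row x = k" using x(3) by (auto simp: pigeon_clause_def)
    then have "k = (if col x = j then Suc h else i)" by (auto simp: place_def before_def)
    then consider "k = i" | "k = Suc h" by metis
    then show ?thesis
    proof cases
      case 1
      then have "?sat (Pos (pvar i j))"
        using h \<open>D = pigeon_clause n k\<close> by (auto simp: pigeon_clause_def after_def)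
      then show ?thesis ..
    next
      case 2
      then have "?sat (Pos (pvar (Suc h) h))"
        using h \<open>D = pigeon_clause n k\<close> by (auto simp: pigeon_clause_def after_def)
      then show ?thesis ..
    qed
  next
    case (2 y z)
    then have "col y \<in> {j, h}" "row y \<le> n" "row z \<le> n" using x by (auto simp: php_vars_def)
    then have "?sat (Neg y) \<or> ?sat (Neg z)" using 2 by (auto simp: place_def)
    then show ?thesis by blast
  next
    case (3 y)
    then have "col y \<in> {j, h}" "row y \<le> n" using x by (auto simp: php_vars_def)
    then have "?sat (Pos y) \<or> ?sat (Neg (twin y))" using 3 by auto
    then show ?thesis by blast
  next
    \<comment> \<open>The descending order matters: only levels \<open>h' \<ge> h\<close> are
      present. On the same level, the swap puts pigeon \<open>h + 1\<close> into hole
      \<open>h\<close> in place of any \<open>i' \<le> h\<close>; on a higher level, neither swapped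
      pigeon is \<open>h' + 1\<close>.\<close>
    case (4 h' i' j')
    show ?thesis
    proof (cases "h' = h")
      case True
      then have "?sat (Neg (pvar i' h))"
        using 4 h by (auto simp: swap_clause_def before_def after_def)
      then show ?thesis ..
    next
      case False
      then have "j' \<in> {j, h}" using 4 h x by (auto simp: swap_clause_def)
      then have "?sat (Neg (pvar (Suc h') j'))"
        using 4 h False by (auto simp: swap_clause_def before_def after_def)
      then show ?thesis ..
    qed
  qed
  then show "\<exists>l\<in>D. row (lvar l) \<le> n \<and> col (lvar l) \<in> {j, h} \<and> holds (place (after h i j)) l"
    by blast
qed

lemma reach_swap_clauses:
  assumes "m \<le> n"
  shows "reach (php_vars n) ((n - m) * (n * n)) (php n) (php n \<union> swap_clauses n m)"
  using assms
proof (induction m rule: inc_induct)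
  case base
  have "swap_clauses n n = {}" by (auto simp: swap_clauses_def)
  then show ?case by (simp add: reach.refl)
next
  case (step m)
  let ?S = "(\<lambda>(i, j). swap_clause n m i j) ` ({..m} \<times> {..<m})"
  have eq: "php n \<union> swap_clauses n (Suc m) \<union> ?S = php n \<union> swap_clauses n m"
  proof -
    have "swap_clauses n (Suc m) \<subseteq> swap_clauses n m" "?S \<subseteq> swap_clauses n m"
      using step.hyps unfolding swap_clauses_def by force+
    moreover have "C \<in> swap_clauses n (Suc m) \<union> ?S" if mem: "C \<in> swap_clauses n m" for C
    proof -
      obtain h i j where C: "C = swap_clause n h i j" "m \<le> h" "h < n" "i \<le> h" "j < h"
        using mem unfolding swap_clauses_def by blast
      show ?thesis
      proof (cases "h = m")
        case True
        then have "(i, j) \<in> {..m} \<times> {..<m}" using C by simp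
        then show ?thesis using C True by blast
      next
        case False
        then have "Suc m \<le> h" using C by simp
        then show ?thesis using C unfolding swap_clauses_def by blast
      qed
    qed
    ultimately show ?thesis by blast
  qed
  have "card ?S \<le> card ({..m} \<times> {..<m})" by (rule card_image_le) auto
  also have "\<dots> \<le> n * n" using step.hyps mult_le_mono[of "Suc m" n m n] by (simp add: card_cartesian_product)
  finally have card: "card ?S \<le> n * n" .
  have "reach (php_vars n) (card ?S) (php n \<union> swap_clauses n (Suc m))
      (php n \<union> swap_clauses n (Suc m) \<union> ?S)"
  proof (rule reach_sbcs)
    fix C assume "C \<in> ?S"
    then obtain i j where "C = swap_clause n m i j" "i \<le> m" "j < m" by auto
    then show "sbc (php n \<union> swap_clauses n (Suc m) \<union> ?S) C \<and> lvar ` C \<subseteq> php_vars n"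
      unfolding eq using sbc_swap_clauses[of m n i j] lvar_swap_clause[of j n m i] step.hyps by auto
  qed simp
  from reach_trans[OF this step.IH] have
    "reach (php_vars n) ((n - Suc m) * (n * n) + n * n) (php n) (php n \<union> swap_clauses n m)"
    unfolding eq by (rule reach_mono) (use card in auto)
  moreover have "(n - m) * (n * n) = (n - Suc m) * (n * n) + n * n"
    using step.hyps by (metis Suc_diff_Suc add.commute mult_Suc)
  ultimately show ?case by simp
qed

section \<open>Refutation by resolution from the swap clauses\<close>

lemma hole_axiom:
  assumes "x \<in> php_vars n" "y \<in> php_vars n" "col x = col y" "row x \<noteq> row y"
  shows "{Neg x, Neg y} \<in> php n"
  using assms unfolding php_def by blast

text \<open>A uniform budget for hyperresolution: there are at most \<open>4 * (n * (n + 1))\<close>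
  literals over \<open>php_vars n\<close>, and the remaining \<open>n * (n + 1)\<close> covers the
  final weakening unless \<open>n = 0\<close>.\<close>

lemma provable_php:
  assumes "E \<in> \<Delta>" "E \<subseteq> A \<union> U" "is_clause (A \<union> U)" "lvar ` (A \<union> U) \<subseteq> php_vars n"
    and "\<And>l. l \<in> U \<Longrightarrow> l \<notin> A \<and> (\<exists>D\<in>\<Delta>. compl l \<in> D \<and> D \<subseteq> insert (compl l) A \<and> is_clause D)"
  shows "provable (php_vars n) (5 * (n * (n + 1))) \<Delta> {A}"
proof (cases "n = 0")
  case True
  then have "A \<union> U = {}" using assms(4) by (auto simp: php_vars_def)
  then show ?thesis using assms(1,2) by (auto simp: provable_def intro: reach.refl)
next
  case False
  have U: "finite U" "card U \<le> 2 * card (php_vars n)"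
    using lvar_image_finite[of "php_vars n" U] assms(4) by auto
  then have "Suc (card U) \<le> 5 * (n * (n + 1))"
    using card_php_vars[of n] False by auto
  with provable_hyperresolution[OF U(1) assms] show ?thesis
    by (rule provable_mono) auto
qed

text \<open>Knowing the pigeons in holes \<open>h\<close> and \<open>j\<close> fixes both columns:
  hole axioms refute the positive literals of the swap clause, and twin axioms its negative literals
  on second copies.\<close>

lemma provable_swap:
  assumes h: "h < n" "i \<le> h" "j < h"
  shows "provable (php_vars n) (5 * (n * (n + 1))) (php n \<union> swap_clauses n 0)
    {{Neg (pvar i h), Neg (pvar (Suc h) j)}}"
proof -
  let ?C = "swap_clause n h i j" and ?A = "{Neg (pvar i h), Neg (pvar (Suc h) j)}"
  have A: "?A \<subseteq> ?C" using h by (auto simp: swap_clause_def before_def)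
  show ?thesis
  proof (rule provable_php[of ?C _ _ "?C - ?A"])
    show "?C \<in> php n \<union> swap_clauses n 0" using h by (auto simp: swap_clauses_def)
    have eq: "?A \<union> (?C - ?A) = ?C" using A by blast
    show "?C \<subseteq> ?A \<union> (?C - ?A)" by blast
    show "is_clause (?A \<union> (?C - ?A))" "lvar ` (?A \<union> (?C - ?A)) \<subseteq> php_vars n"
      unfolding eq using h is_clause_swap_clause[of j n h i] lvar_swap_clause[of j n h i] by auto
    fix l assume l: "l \<in> ?C - ?A"
    have "\<exists>D\<in>php n. compl l \<in> D \<and> D \<subseteq> insert (compl l) ?A"
    proof (cases l)
      case (Pos x)
      then have x: "x \<in> php_vars n" "row x \<noteq> before h i j (col x)" "col x \<in> {j, h}"
        using l h by (auto simp: swap_clause_def php_vars_def place_def)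
      let ?y = "pvar (before h i j (col x)) (col x)"
      have "?y \<in> php_vars n" "Neg ?y \<in> ?A" using x(3) h by (auto simp: before_def)
      moreover have "{Neg x, Neg ?y} \<in> php n" using x h by (intro hole_axiom) (auto simp: before_def)
      ultimately show ?thesis using Pos by (intro bexI[of _ "{Neg x, Neg ?y}"]) auto
    next
      case (Neg x)
      then have x: "x \<in> php_vars n" "row x = before h i j (col x)" "col x \<in> {j, h}"
        using l h by (auto simp: swap_clause_def php_vars_def place_def)
      then have "Neg (pvar (row x) (col x)) \<in> ?A" by (auto simp: before_def)
      moreover have "x = twin (pvar (row x) (col x))"
        using pvar_cases[of x] l Neg calculation by auto
      then have "twin x = pvar (row x) (col x)" by (metis twin_twin)
      ultimately have "Neg (twin x) \<in> ?A" by simp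
      moreover have "{Pos x, Neg (twin x)} \<in> php n" using x unfolding php_def by blast
      ultimately show ?thesis using Neg by (intro bexI[of _ "{Pos x, Neg (twin x)}"]) auto
    qed
    then show "l \<notin> ?A \<and> (\<exists>D\<in>php n \<union> swap_clauses n 0. compl l \<in> D \<and> D \<subseteq> insert (compl l) ?A \<and> is_clause D)"
      using l is_cnf_php[of n] unfolding is_cnf_def by blast
  qed
qed

lemma is_clause_pigeon_clause: "is_clause (pigeon_clause m i)"
  by (auto simp: is_clause_def tautological_def pigeon_clause_def)

text \<open>If a pigeon \<open>i \<le> h\<close> sat in hole \<open>h\<close>, the clauses
  \<open>R\<close> would bar pigeon \<open>h + 1\<close> from the holes below \<open>h\<close>, and
  a hole axiom from \<open>h\<close> itself, leaving it nowhere to go. The resulting units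
  \<open>U\<close> delete hole \<open>h\<close> from the clauses of the pigeons up to
  \<open>h\<close>. The three stages take at most \<open>n * n\<close>, \<open>n\<close> and
  \<open>n\<close> hyperresolutions.\<close>

lemma provable_level:
  assumes h: "h < n"
  shows "provable (php_vars n) ((n * n + 2 * n) * (5 * (n * (n + 1))))
    (php n \<union> swap_clauses n 0 \<union> pigeon_clause (Suc h) ` {..Suc h}) (pigeon_clause h ` {..h})"
proof -
  let ?X = "php_vars n" and ?b = "5 * (n * (n + 1))"
  let ?\<Delta> = "php n \<union> swap_clauses n 0 \<union> pigeon_clause (Suc h) ` {..Suc h}"
  define R where "R = (\<lambda>(i, j). {Neg (pvar i h), Neg (pvar (Suc h) j)}) ` ({..h} \<times> {..<h})"
  define U where "U = (\<lambda>i. {Neg (pvar i h)}) ` {..h}"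
  have R: "provable ?X (n * n * ?b) ?\<Delta> R"
  proof -
    have prov: "provable ?X (card ({..h} \<times> {..<h}) * ?b) ?\<Delta> R"
      unfolding R_def
    proof (rule provable_image)
      fix e assume "e \<in> {..h} \<times> {..<h}"
      then have "provable ?X ?b (php n \<union> swap_clauses n 0) {{Neg (pvar (fst e) h), Neg (pvar (Suc h) (snd e))}}"
        using h by (intro provable_swap) auto
      then show "provable ?X ?b ?\<Delta> {(\<lambda>(i, j). {Neg (pvar i h), Neg (pvar (Suc h) j)}) e}"
        by (rule provable_mono) (auto simp: case_prod_beta)
    qed simp
    have "card ({..h} \<times> {..<h}) \<le> n * n"
      using h mult_le_mono[of "Suc h" n h n] by (simp add: card_cartesian_product)
    then show ?thesis by (intro provable_mono[OF prov] mult_right_mono) auto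
  qed
  have U: "provable ?X (n * ?b) (?\<Delta> \<union> R) U"
  proof -
    have "provable ?X (card {..h} * ?b) (?\<Delta> \<union> R) U"
      unfolding U_def
    proof (rule provable_image)
      fix i assume i: "i \<in> {..h}"
      let ?E = "pigeon_clause (Suc h) (Suc h)" and ?A = "{Neg (pvar i h)}"
      show "provable ?X ?b (?\<Delta> \<union> R) {?A}"
      proof (rule provable_php[of ?E _ _ ?E])
        show "is_clause (?A \<union> ?E)"
          using i is_clause_pigeon_clause[of "Suc h" "Suc h"]
          by (auto simp: is_clause_def tautological_def pigeon_clause_def dest: arg_cong[of _ _ row])
        show "lvar ` (?A \<union> ?E) \<subseteq> ?X" using h i by (auto simp: pigeon_clause_def)
        fix l assume "l \<in> ?E"
        then obtain j where j: "l = Pos (pvar (Suc h) j)" "j \<le> h" by (auto simp: pigeon_clause_def)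
        have "{Neg (pvar i h), Neg (pvar (Suc h) j)} \<in> ?\<Delta> \<union> R"
        proof (cases "j = h")
          case True
          then have "{Neg (pvar i h), Neg (pvar (Suc h) j)} \<in> php n"
            using h i by (intro hole_axiom) auto
          then show ?thesis by blast
        next
          case False
          then have "(i, j) \<in> {..h} \<times> {..<h}" using i j by auto
          then show ?thesis unfolding R_def by blast
        qed
        moreover have "is_clause {Neg (pvar i h), Neg (pvar (Suc h) j)}"
          by (auto simp: is_clause_def tautological_def)
        ultimately show "l \<notin> ?A \<and> (\<exists>D\<in>?\<Delta> \<union> R. compl l \<in> D \<and> D \<subseteq> insert (compl l) ?A \<and> is_clause D)"
          using j by (intro conjI bexI[of _ "{Neg (pvar i h), Neg (pvar (Suc h) j)}"]) auto
      qed auto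
    qed simp
    then show ?thesis by (rule provable_mono[OF _ mult_right_mono]) (use h in auto)
  qed
  have P: "provable ?X (n * ?b) (?\<Delta> \<union> (R \<union> U)) (pigeon_clause h ` {..h})"
  proof -
    have "provable ?X (card {..h} * ?b) (?\<Delta> \<union> (R \<union> U)) (pigeon_clause h ` {..h})"
    proof (rule provable_image)
      fix i assume i: "i \<in> {..h}"
      let ?E = "pigeon_clause (Suc h) i" and ?U = "{Pos (pvar i h)}"
      have E: "?E = pigeon_clause h i \<union> ?U"
        by (auto simp: pigeon_clause_def less_Suc_eq)
      show "provable ?X ?b (?\<Delta> \<union> (R \<union> U)) {pigeon_clause h i}"
      proof (rule provable_php[of ?E _ _ ?U])
        show "?E \<in> ?\<Delta> \<union> (R \<union> U)" using i by auto
        show "?E \<subseteq> pigeon_clause h i \<union> ?U" "is_clause (pigeon_clause h i \<union> ?U)"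
          using is_clause_pigeon_clause[of "Suc h" i] E by auto
        show "lvar ` (pigeon_clause h i \<union> ?U) \<subseteq> ?X" using i h by (auto simp: pigeon_clause_def)
        fix l assume l: "l \<in> ?U"
        have "{Neg (pvar i h)} \<in> ?\<Delta> \<union> (R \<union> U)" using i by (auto simp: U_def)
        moreover have "is_clause {Neg (pvar i h)}" by (auto simp: is_clause_def tautological_def)
        moreover have "l \<notin> pigeon_clause h i"
          using l by (auto simp: pigeon_clause_def dest: arg_cong[of _ _ col])
        ultimately show "l \<notin> pigeon_clause h i \<and>
            (\<exists>D\<in>?\<Delta> \<union> (R \<union> U). compl l \<in> D \<and> D \<subseteq> insert (compl l) (pigeon_clause h i) \<and> is_clause D)"
          using l by (intro conjI bexI[of _ "{Neg (pvar i h)}"]) auto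
      qed
    qed simp
    then show ?thesis by (rule provable_mono[OF _ mult_right_mono]) (use h in auto)
  qed
  have "provable ?X (n * n * ?b + n * ?b + n * ?b) ?\<Delta> (R \<union> U \<union> pigeon_clause h ` {..h})"
    by (intro provable_trans[OF provable_trans[OF R U]] P)
  then show ?thesis by (rule provable_mono) (auto simp: algebra_simps)
qed

lemma provable_pigeon_clauses:
  assumes "m \<le> n"
  shows "provable (php_vars n) ((n - m) * ((n * n + 2 * n) * (5 * (n * (n + 1)))))
    (php n \<union> swap_clauses n 0) (pigeon_clause m ` {..m})"
  using assms
proof (induction m rule: inc_induct)
  case base
  have "pigeon_clause n ` {..n} \<subseteq> php n" by (auto simp: php_def)
  then show ?case by (auto simp: provable_def intro: reach.refl)
next
  case (step m)
  let ?b = "(n * n + 2 * n) * (5 * (n * (n + 1)))"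
  have eq: "(n - m) * ?b = (n - Suc m) * ?b + ?b"
    using step.hyps by (metis Suc_diff_Suc add.commute mult_Suc)
  have "provable (php_vars n) ((n - Suc m) * ?b + ?b) (php n \<union> swap_clauses n 0)
      (pigeon_clause (Suc m) ` {..Suc m} \<union> pigeon_clause m ` {..m})"
    using step.hyps by (intro provable_trans[OF step.IH provable_level])
  then show ?case
    unfolding eq by (rule provable_mono) auto
qed

lemma sbc_minus_php_polynomial:
  assumes "n \<ge> 1"
  shows "\<exists>\<Delta>s. sbc_minus_proof (php n) \<Delta>s \<and> length \<Delta>s \<le> 32 * n ^ 5"
proof -
  let ?b = "n * ((n * n + 2 * n) * (5 * (n * (n + 1))))"
  obtain \<Delta> where \<Delta>: "reach (php_vars n) ?b (php n \<union> swap_clauses n 0) \<Delta>" "pigeon_clause 0 ` {..0} \<subseteq> \<Delta>"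
    using provable_pigeon_clauses[of 0 n] unfolding provable_def by auto
  have reach: "reach (php_vars n) (n * (n * n) + ?b) (php n) \<Delta>"
    using reach_trans[OF \<Delta>(1)] reach_swap_clauses[of 0 n] by simp
  \<comment> \<open>With no holes left, the clause of pigeon 0 is empty.\<close>
  have "{} \<in> \<Delta>" using \<Delta>(2) by (simp add: pigeon_clause_def)
  from reach_sbc_proof[OF reach is_cnf_php cnf_vars_php this]
  obtain \<Delta>s where \<Delta>s: "sbc_minus_proof (php n) \<Delta>s" "length \<Delta>s \<le> Suc (n * (n * n) + ?b)" by blast
  obtain m where m: "n = Suc m" using assms by (cases n) auto
  \<comment> \<open>The 32 splits into 30 for the resolution phase, 1 for the swap clauses and 1 for
    the initial CNF.\<close>
  have "Suc (n * (n * n) + ?b) \<le> 32 * n ^ 5"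
  proof -
    have "?b \<le> n * ((n * n + 2 * n * n) * (5 * (n * (n + n))))"
      using assms by (intro mult_mono add_mono) auto
    also have "\<dots> = 30 * n ^ 5" by (simp add: power_numeral_reduce)
    finally have "?b \<le> 30 * n ^ 5" .
    moreover have "n ^ 3 \<le> n ^ 5" "1 \<le> n ^ 5" using assms by (auto intro: power_increasing)
    moreover have "n * (n * n) = n ^ 3" by (simp add: power_numeral_reduce)
    ultimately show ?thesis by linarith
  qed
  then show ?thesis using \<Delta>s by (intro exI[of _ \<Delta>s]) linarith
qed

theorem theorem1p4:
  "\<exists>\<Gamma> :: nat \<Rightarrow> nat cnf.
     (\<forall>n\<ge>1. is_cnf (\<Gamma> n)) \<and>
     (\<exists>K c :: nat. \<forall>n\<ge>1. \<exists>\<Delta>s. sbc_minus_proof (\<Gamma> n) \<Delta>s \<and> length \<Delta>s \<le> K * n ^ c) \<and>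
     (\<exists>\<epsilon> > 0 :: real. \<forall>\<^sub>F n in sequentially.
        \<forall>\<Delta>s. rat_minus_proof (\<Gamma> n) \<Delta>s \<longrightarrow> real (length \<Delta>s) \<ge> 2 powr (\<epsilon> * real n))"
proof (intro exI[of _ php] conjI)
  show "\<forall>n\<ge>1. is_cnf (php n)" by (simp add: is_cnf_php)
  show "\<exists>K c :: nat. \<forall>n\<ge>1. \<exists>\<Delta>s. sbc_minus_proof (php n) \<Delta>s \<and> length \<Delta>s \<le> K * n ^ c"
    using sbc_minus_php_polynomial by (intro exI[of _ 32] exI[of _ 5]) simp
qed (rule rat_minus_php_exponential)

end
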